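(* Let $\varepsilon\dot X=f(t,X,\varepsilon)$ satisfy hypotheses (H1)–(H4) of the context (Hopf bifurcation at $t=a$), and assume that there exists a solution $\tilde X(t)$ of this equation going along the slow curve $X=\phi(t)$ at least on $]t_m,t_M[$. If a solution $X(t)$ of the equation goes along the slow curve exactly on $]t_e,t_s[$, with $[t_e,t_s]\subset\,]t_m,t_M[$, then $$\int_{t_e}^{t_s}\Re(\lambda(\tau))\,d\tau=0 .$$
   Context: The language is Nelson's nonstandard analysis: $x\simeq y$ means that $x-y$ is infinitesimal. The function $f$, the domains, $\phi$, $a$, $t_m$, $t_M$, and the endpoints of the intervals below are standard ($t_m=-\infty$ and $t_M=+\infty$ are allowed); $\varepsilon$ is a fixed parameter. The equation is $\varepsilon\dot X=f(t,X,\varepsilon)$, with $X$ two-dimensional, $\dot X=dX/dt$; solutions are real, for real $t$. Hypotheses: (H1) $f$ is analytic on a domain $\mathcal D\subset\mathbb C\times\mathbb C^2\times\mathbb C$ and takes real values when its arguments are real. (H2) $\varepsilon$ is real, positive and infinitesimal. (H3) There is an analytic function $\phi$ on a complex domain $\mathcal D_t$ with $f(t,\phi(t),0)=0$ for all $t\in\mathcal D_t$. The curve $X=\phi(t)$ is called the slow curve. The intersection of $\mathcal D_t$ with the real axis is an interval $]t_m,t_M[$. (H4) Let $\lambda(t),\mu(t)$ be the eigenvalues of the Jacobian matrix $D_Xf(t,\phi(t),0)$. There is $a\in\,]t_m,t_M[$ such that, for real $t\in\,]t_m,t_M[$: $\Re\lambda(t)$ and $\Re\mu(t)$ are negative for $t<a$,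 zero for $t=a$, positive for $t>a$; and $\Im\lambda(t)<0<\Im\mu(t)$ for all $t$. Definitions. The $S$-interior of an interval $]t_1,t_2[$ is the set of limited (finite) $t\in\,]t_1,t_2[$ that are not infinitely close to an endpoint. A solution $X(t)$ goes along the slow curve at least on $]t_1,t_2[$ if $X(t)\simeq\phi(t)$ for all $t$ in the $S$-interior of $]t_1,t_2[$. It goes along the slow curve exactly on $]t_e,t_s[$ if it goes along the slow curve at least on $]t_e,t_s[$ and the interval $]t_e,t_s[$ is maximal for this property. *)

theory Defs
  imports "HOL-Complex_Analysis.Complex_Analysis"
begin

text \<open>
  Nonstandard analysis is rendered by ultrapowers. An ultrafilter \<open>F\<close> on an arbitrary index type is
  given; an internal object is a family over the index type, a standard object is a constant
  family, an internal statement holds when it holds for \<open>F\<close>-almost all indices, and the external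
  quantifiers over standard numbers are the ordinary quantifiers of HOL. Families are not
  quotiented by \<open>F\<close>-almost everywhere equality, as every notion below respects it. No freeness of
  \<open>F\<close> is needed, since a positive infinitesimal exists only if \<open>F\<close> is not principal.
\<close>

definition ultrafilter :: "'i filter \<Rightarrow> bool" where
  "ultrafilter F \<longleftrightarrow> F \<noteq> bot \<and> (\<forall>P. eventually P F \<or> eventually (\<lambda>i. \<not> P i) F)"

definition infinitesimal :: "'i filter \<Rightarrow> ('i \<Rightarrow> 'a::real_normed_vector) \<Rightarrow> bool" where
  "infinitesimal F x \<longleftrightarrow> (\<forall>r>0. \<forall>\<^sub>F i in F. norm (x i) < r)"

definition infinitely_close ::
    "'i filter \<Rightarrow> ('i \<Rightarrow> 'a::real_normed_vector) \<Rightarrow> ('i \<Rightarrow> 'a) \<Rightarrow> bool" where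
  "infinitely_close F x y \<longleftrightarrow> infinitesimal F (\<lambda>i. x i - y i)"

definition limited :: "'i filter \<Rightarrow> ('i \<Rightarrow> 'a::real_normed_vector) \<Rightarrow> bool" where
  "limited F x \<longleftrightarrow> (\<exists>r. \<forall>\<^sub>F i in F. norm (x i) \<le> r)"

text \<open>
  The endpoints are standard, possibly infinite; a limited number is never infinitely close to an
  infinite endpoint, so only real endpoints have to be kept away from.
\<close>

definition S_interior :: "'i filter \<Rightarrow> ereal \<Rightarrow> ereal \<Rightarrow> ('i \<Rightarrow> real) set" where
  "S_interior F t1 t2 =
     {t. limited F t \<and> (\<forall>\<^sub>F i in F. t1 < ereal (t i) \<and> ereal (t i) < t2) \<and>
         (\<forall>r. ereal r = t1 \<or> ereal r = t2 \<longrightarrow> \<not> infinitely_close F t (\<lambda>i. r))}"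

definition complex_vec :: "real^'n \<Rightarrow> complex^'n" where
  "complex_vec x = (\<chi> k. complex_of_real (x $ k))"

text \<open>
  Analyticity for functions of \<open>(t, X, \<epsilon>)\<close>, in the style of \<^const>\<open>analytic_on\<close>: complex
  differentiability in a neighbourhood of each point. A complex derivative is a real Frechet
  derivative that commutes with multiplication by complex scalars.
\<close>

fun cscale :: "complex \<Rightarrow> complex \<times> (complex^'n) \<times> complex \<Rightarrow> complex \<times> (complex^'n) \<times> complex" where
  "cscale c (t, x, e) = (c * t, c *s x, c * e)"

definition cdifferentiable_at ::
    "(complex \<times> (complex^'n) \<times> complex \<Rightarrow> complex^'m) \<Rightarrow> complex \<times> (complex^'n) \<times> complex \<Rightarrow> bool" where
  "cdifferentiable_at f z \<longleftrightarrow>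
     (\<exists>f'. (f has_derivative f') (at z) \<and> (\<forall>c h. f' (cscale c h) = c *s f' h))"

definition canalytic_on ::
    "(complex \<times> (complex^'n) \<times> complex \<Rightarrow> complex^'m) \<Rightarrow> (complex \<times> (complex^'n) \<times> complex) set \<Rightarrow> bool"
  where "canalytic_on f D \<longleftrightarrow> (\<forall>z\<in>D. \<exists>r>0. \<forall>w\<in>ball z r. cdifferentiable_at f w)"

text \<open>
  The derivative below is \<open>\<complex>\<close>-linear where \<open>f\<close> is analytic, so this is the complex Jacobian matrix.
\<close>

definition jacobian_X ::
    "(complex \<times> (complex^'n) \<times> complex \<Rightarrow> complex^'m) \<Rightarrow> complex \<Rightarrow> complex^'n \<Rightarrow> complex \<Rightarrow> complex^'n^'m"
  where "jacobian_X f t x e = jacobian (\<lambda>y. f (t, y, e)) (at x)"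

definition eigenvalues :: "complex^'n^'n \<Rightarrow> complex set" where
  "eigenvalues A = {c. \<exists>v. v \<noteq> 0 \<and> A *v v = c *s v}"

definition solution_on ::
    "(complex \<times> (complex^'n) \<times> complex \<Rightarrow> complex^'n) \<Rightarrow> (complex \<times> (complex^'n) \<times> complex) set \<Rightarrow> real
      \<Rightarrow> real set \<Rightarrow> (real \<Rightarrow> real^'n) \<Rightarrow> bool" where
  "solution_on f D e J X \<longleftrightarrow> J \<noteq> {} \<and> open J \<and> is_interval J \<and>
     (\<forall>t\<in>J. (complex_of_real t, complex_vec (X t), complex_of_real e) \<in> D \<and>
        (\<exists>X'. (X has_vector_derivative X') (at t) \<and>
           complex_of_real e *s complex_vec X'
             = f (complex_of_real t, complex_vec (X t), complex_of_real e)))"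

definition maximal_solution_on ::
    "(complex \<times> (complex^'n) \<times> complex \<Rightarrow> complex^'n) \<Rightarrow> (complex \<times> (complex^'n) \<times> complex) set \<Rightarrow> real
      \<Rightarrow> real set \<Rightarrow> (real \<Rightarrow> real^'n) \<Rightarrow> bool" where
  "maximal_solution_on f D e J X \<longleftrightarrow> solution_on f D e J X \<and>
     (\<forall>J' X'. solution_on f D e J' X' \<and> J \<subseteq> J' \<and> (\<forall>t\<in>J. X' t = X t) \<longrightarrow> J' = J)"

text \<open>
  \<open>X\<close> is an internal function with internal domain \<open>J\<close>. The values \<open>X t\<close> and \<open>\<phi> t\<close> are meaningful only
  for \<open>t\<close> in \<open>J\<close> and in \<open>Dt\<close>, the domain of \<open>\<phi>\<close>, which is therefore part of the condition.
\<close>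

definition goes_along_at_least ::
    "'i filter \<Rightarrow> complex set \<Rightarrow> (complex \<Rightarrow> complex^'n) \<Rightarrow> ('i \<Rightarrow> real set) \<Rightarrow> ('i \<Rightarrow> real \<Rightarrow> real^'n)
      \<Rightarrow> ereal \<Rightarrow> ereal \<Rightarrow> bool" where
  "goes_along_at_least F Dt \<phi> J X t1 t2 \<longleftrightarrow>
     (\<forall>t\<in>S_interior F t1 t2.
        (\<forall>\<^sub>F i in F. t i \<in> J i \<and> complex_of_real (t i) \<in> Dt) \<and>
        infinitely_close F (\<lambda>i. complex_vec (X i (t i))) (\<lambda>i. \<phi> (complex_of_real (t i))))"

definition goes_along_exactly ::
    "'i filter \<Rightarrow> complex set \<Rightarrow> (complex \<Rightarrow> complex^'n) \<Rightarrow> ('i \<Rightarrow> real set) \<Rightarrow> ('i \<Rightarrow> real \<Rightarrow> real^'n)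
      \<Rightarrow> ereal \<Rightarrow> ereal \<Rightarrow> bool" where
  "goes_along_exactly F Dt \<phi> J X te ts \<longleftrightarrow> goes_along_at_least F Dt \<phi> J X te ts \<and>
     (\<forall>t1 t2. t1 \<le> te \<and> ts \<le> t2 \<and> goes_along_at_least F Dt \<phi> J X t1 t2 \<longrightarrow> t1 = te \<and> t2 = ts)"

end

theory Submission imports Defs begin

text \<open>
  The theorem compares \<open>X\<close> with the solution \<open>X0\<close> that follows the slow curve all the way. The
  difference \<open>Y = X - X0\<close> satisfies \<open>\<epsilon> Y' = (A(t) + small) Y\<close> as long as both solutions are near the
  curve, where \<open>A(t)\<close> is the Jacobian matrix on the curve. It is a real \<open>2 \<times> 2\<close> matrix with a pair of
  conjugate, non-real eigenvalues, so up to a bounded change of norm it is \<open>\<alpha>(t) = Re (lam t)\<close> times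
  the identity plus a rotation. Hence \<open>\<epsilon> ln \<bar>Y\<bar>\<close> changes between two times by the integral of \<open>\<alpha>\<close>, up
  to an infinitesimal error (\<open>linear_ode_growth\<close>, \<open>solutions_near_slow_curve_separate\<close>).

  Near the two ends of the interval that \<open>X\<close> follows exactly, \<open>\<epsilon> ln \<bar>Y\<bar>\<close> is infinitesimal. It cannot be
  appreciably positive, as \<open>Y\<close> is bounded. If it were below some standard \<open>- \<gamma> < 0\<close> at a time close to
  \<open>ts\<close>, then \<open>Y\<close> would remain exponentially small on a standard interval that reaches beyond \<open>ts\<close>, so
  \<open>X\<close> would follow the slow curve beyond \<open>ts\<close>, against the maximality of the interval; the same holds
  at \<open>te\<close> with time reversed (\<open>exponentially_close_solution_stays\<close>). Comparing the two ends gives the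
  vanishing of the integral.

  That \<open>X\<close> really exists beyond \<open>ts\<close> is a continuation theorem: a maximal solution that stays away from
  the boundary of a tube on which the field is Lipschitz cannot stop
  (\<open>maximal_ode_solution_trapped\<close>, by way of \<open>picard_lindelof_right\<close>). The regularity of the field in
  \<open>(t, X, \<epsilon>)\<close> near the curve comes from Cauchy's estimates, which make the complex derivative uniformly
  continuous near compact sets (\<open>frechet_derivative_uniformly_continuous_near_compact\<close>).

  All estimates concern a single index, with constants that depend on standard data only. The
  passage from and to nonstandard statements rests on the fact that closeness at every internal
  point of a standard compact interval is uniform closeness on it, for almost all indices
  (\<open>goes_along_at_least_uniformly\<close>, \<open>goes_along_at_leastI\<close>).
\<close>

text \<open>In what follows \<open>$\<close> always selects a component of a vector.\<close>

no_notation fps_nth (infixl "$" 75)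

section \<open>The complex derivative near a compact set\<close>

lemma norm_vector_scalar_mult:
  fixes x :: "complex^'n"
  shows "norm (c *s x) = cmod c * norm x"
  by (simp add: norm_vec_def L2_set_def norm_mult power_mult_distrib real_sqrt_mult
        flip: sum_distrib_left)

lemma norm_cscale: "norm (cscale c z) = cmod c * norm z"
proof -
  obtain t x e where "z = (t, x, e)" by (cases z) auto
  then show ?thesis
    by (simp add: norm_Pair norm_mult norm_vector_scalar_mult power_mult_distrib
          real_sqrt_mult flip: distrib_left)
qed

lemma bounded_linear_cscale: "bounded_linear (\<lambda>c. cscale c z)"
proof -
  obtain t x e where z: "z = (t, x, e)" by (cases z) auto
  show ?thesis
  proof (rule bounded_linear_intro[where K = "norm z"])
    show "norm (cscale c z) \<le> norm c * norm z" for c by (simp add: norm_cscale)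
  qed (simp_all add: z vec_eq_iff distrib_right scaleR_conv_of_real[where 'a = complex])
qed

lemma canalytic_on_frechet_derivative:
  assumes "canalytic_on f D" "z \<in> D"
  shows "(f has_derivative frechet_derivative f (at z)) (at z)"
    and "frechet_derivative f (at z) (cscale c h) = c *s frechet_derivative f (at z) h"
proof -
  have "cdifferentiable_at f z"
    using assms by (metis canalytic_on_def centre_in_ball)
  then obtain f' where f': "(f has_derivative f') (at z)" "\<And>c h. f' (cscale c h) = c *s f' h"
    unfolding cdifferentiable_at_def by blast
  then have "f' = frechet_derivative f (at z)"
    by (simp add: frechet_derivative_at)
  with f' show "(f has_derivative frechet_derivative f (at z)) (at z)"
    "frechet_derivative f (at z) (cscale c h) = c *s frechet_derivative f (at z) h" by auto
qed

text \<open>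
  Restricting to complex lines reduces everything about the derivative to functions of one complex
  variable.
\<close>

lemma has_field_derivative_on_complex_line:
  assumes "canalytic_on f D" "z + cscale \<zeta> v \<in> D"
  shows "((\<lambda>\<zeta>. f (z + cscale \<zeta> v) $ j) has_field_derivative
           frechet_derivative f (at (z + cscale \<zeta> v)) v $ j) (at \<zeta>)"
proof -
  let ?f' = "frechet_derivative f (at (z + cscale \<zeta> v))"
  note f' = canalytic_on_frechet_derivative[OF assms]
  have line: "((\<lambda>\<zeta>. z + cscale \<zeta> v) has_derivative (\<lambda>h. cscale h v)) (at \<zeta>)"
    by (rule derivative_eq_intros bounded_linear_imp_has_derivative bounded_linear_cscale refl)+ simp
  have "((\<lambda>\<zeta>. f (z + cscale \<zeta> v)) has_derivative (\<lambda>h. ?f' (cscale h v))) (at \<zeta>)"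
    by (rule has_derivative_compose[OF line]) (rule f'(1))
  then have "((\<lambda>\<zeta>. f (z + cscale \<zeta> v) $ j) has_derivative (\<lambda>h. ?f' (cscale h v) $ j)) (at \<zeta>)"
    by (rule bounded_linear.has_derivative[OF bounded_linear_vec_nth])
  moreover have "(\<lambda>h. ?f' (cscale h v) $ j) = (*) (?f' v $ j)"
    by (simp add: f'(2) fun_eq_iff mult.commute)
  ultimately show ?thesis
    by (simp add: has_field_derivative_def)
qed

lemma canalytic_on_imp_continuous_on:
  assumes "canalytic_on f D" shows "continuous_on D f"
  using canalytic_on_frechet_derivative(1)[OF assms]
  by (meson continuous_at_imp_continuous_on has_derivative_continuous)

text \<open>
  The directional derivatives at \<open>z\<close> and \<open>z'\<close> are derivatives at \<open>0\<close> of functions of one complex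
  variable on the disc of radius \<open>\<rho> / \<bar>v\<bar>\<close>, so Cauchy's estimate bounds their difference by the
  difference of the functions themselves. Continuity of \<open>f\<close> thereby yields continuity of the
  derivative.
\<close>

lemma frechet_derivative_diff_bound:
  fixes f :: "complex \<times> (complex^'n) \<times> complex \<Rightarrow> complex^'m" and \<kappa> \<rho> :: real
  assumes f: "canalytic_on f D"
    and sub: "cball z \<rho> \<subseteq> D" "cball z' \<rho> \<subseteq> D" and "0 < \<rho>"
    and close: "\<And>h. norm h \<le> \<rho> \<Longrightarrow> norm (f (z + h) - f (z' + h)) \<le> \<kappa>"
  shows "norm (frechet_derivative f (at z) v - frechet_derivative f (at z') v)
           \<le> CARD('m) * \<kappa> / \<rho> * norm v"
proof (cases "v = 0")
  case True
  have "z \<in> D" "z' \<in> D" using sub \<open>0 < \<rho>\<close> by (auto dest!: subsetD)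
  then have "linear (frechet_derivative f (at z))" "linear (frechet_derivative f (at z'))"
    using canalytic_on_frechet_derivative(1)[OF f] has_derivative_linear by blast+
  with True show ?thesis by (simp add: linear_0)
next
  case False
  define R where "R = \<rho> / norm v"
  have "0 < R" using False \<open>0 < \<rho>\<close> by (simp add: R_def)
  let ?d = "\<lambda>j. frechet_derivative f (at z) v $ j - frechet_derivative f (at z') v $ j"
  let ?G = "\<lambda>j \<zeta>. f (z + cscale \<zeta> v) $ j - f (z' + cscale \<zeta> v) $ j"
  have small: "norm (cscale \<zeta> v) \<le> \<rho>" if "\<zeta> \<in> cball 0 R" for \<zeta>
    using that False by (simp add: norm_cscale R_def field_simps)
  have inD: "z + cscale \<zeta> v \<in> D" "z' + cscale \<zeta> v \<in> D" if "\<zeta> \<in> cball 0 R" for \<zeta>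
    using small[OF that] subsetD[OF sub(1), of "z + cscale \<zeta> v"] subsetD[OF sub(2), of "z' + cscale \<zeta> v"]
    by (simp_all add: dist_norm)
  have G': "(?G j has_field_derivative
      (frechet_derivative f (at (z + cscale \<zeta> v)) v $ j
        - frechet_derivative f (at (z' + cscale \<zeta> v)) v $ j)) (at \<zeta>)" if "\<zeta> \<in> cball 0 R" for \<zeta> j
    by (intro DERIV_diff has_field_derivative_on_complex_line[OF f] inD that)
  have "norm (?d j) \<le> \<kappa> / R" for j
  proof -
    have hol: "?G j holomorphic_on cball 0 R"
    proof (rule holomorphic_onI)
      fix \<zeta> :: complex assume "\<zeta> \<in> cball 0 R"
      from has_field_derivative_at_within[OF G'[OF this]]
      show "?G j field_differentiable at \<zeta> within cball 0 R"
        unfolding field_differentiable_def by blast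
    qed
    have 0: "cscale 0 v = 0"
      using linear_0[OF bounded_linear.linear[OF bounded_linear_cscale]] .
    have "norm ((deriv ^^ 1) (?G j) 0) \<le> fact 1 * \<kappa> / R ^ 1"
    proof (rule Cauchy_inequality)
      show "?G j holomorphic_on ball 0 R" using hol by (rule holomorphic_on_subset) auto
      show "continuous_on (cball 0 R) (?G j)" using hol by (rule holomorphic_on_imp_continuous_on)
      fix \<zeta> :: complex assume "cmod (0 - \<zeta>) = R"
      then have "norm (cscale \<zeta> v) \<le> \<rho>" by (intro small) simp
      from close[OF this] show "norm (?G j \<zeta>) \<le> \<kappa>"
        using Finite_Cartesian_Product.norm_nth_le[of "f (z + cscale \<zeta> v) - f (z' + cscale \<zeta> v)" j] by simp
    qed (use \<open>0 < R\<close> in auto)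
    moreover have "deriv (?G j) 0 = ?d j"
      using DERIV_imp_deriv[OF G'[of 0 j]] \<open>0 < R\<close> by (simp add: 0)
    ultimately show ?thesis by simp
  qed
  then have "(\<Sum>j\<in>UNIV. norm (?d j)) \<le> (\<Sum>j\<in>(UNIV::'m set). \<kappa> / R)"
    by (intro sum_mono)
  moreover have "norm (frechet_derivative f (at z) v - frechet_derivative f (at z') v)
      \<le> (\<Sum>j\<in>UNIV. norm (?d j))"
    unfolding norm_vec_def vector_minus_component by (rule L2_set_le_sum) simp
  ultimately show ?thesis by (simp add: R_def)
qed

lemma frechet_derivative_uniformly_continuous_near_compact:
  fixes f :: "complex \<times> (complex^'n) \<times> complex \<Rightarrow> complex^'m"
  assumes f: "canalytic_on f D" and "open D" "compact K" "K \<subseteq> D" and "0 < \<eta>"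
  obtains \<delta> where "\<delta> > 0"
    "\<And>z z'. z \<in> K \<Longrightarrow> norm (z' - z) \<le> \<delta> \<Longrightarrow> z' \<in> D"
    "\<And>z z' h. z \<in> K \<Longrightarrow> norm (z' - z) \<le> \<delta> \<Longrightarrow>
      norm (frechet_derivative f (at z') h - frechet_derivative f (at z) h) \<le> \<eta> * norm h"
proof -
  obtain R where R: "R > 0" "(\<Union>z\<in>K. cball z R) \<subseteq> D"
    using compact_subset_open_imp_cball_epsilon_subset[OF assms(3,2,4)] by blast
  define N where "N = {x + y |x y. x \<in> K \<and> y \<in> cball 0 R}"
  have NI: "w \<in> N" if "z \<in> K" "norm (w - z) \<le> R" for w z
  proof -
    have "w = z + (w - z)" "w - z \<in> cball 0 R" using that by (simp_all add: dist_norm norm_minus_commute)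
    with that(1) show ?thesis unfolding N_def by blast
  qed
  have "N \<subseteq> D"
  proof
    fix w assume "w \<in> N"
    then obtain x y where "w = x + y" "x \<in> K" "y \<in> cball 0 R" unfolding N_def by blast
    then have "w \<in> cball x R" by (simp add: dist_norm)
    with R(2) \<open>x \<in> K\<close> show "w \<in> D" by blast
  qed
  have "compact N" unfolding N_def by (intro compact_sums assms compact_cball)
  then have "uniformly_continuous_on N f"
    by (intro compact_uniformly_continuous continuous_on_subset[OF canalytic_on_imp_continuous_on[OF f]]
         \<open>N \<subseteq> D\<close>)
  moreover define \<rho> where "\<rho> = R / 2"
  define \<kappa> where "\<kappa> = \<eta> * \<rho> / CARD('m)"
  have "\<rho> > 0" "\<kappa> > 0" using R(1) \<open>0 < \<eta>\<close> by (simp_all add: \<rho>_def \<kappa>_def)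
  ultimately obtain d where d: "d > 0"
    "\<And>w w'. w \<in> N \<Longrightarrow> w' \<in> N \<Longrightarrow> dist w' w < d \<Longrightarrow> dist (f w') (f w) < \<kappa>"
    unfolding uniformly_continuous_on_def by meson
  define \<delta> where "\<delta> = min \<rho> (d / 2)"
  have \<delta>: "0 < \<delta>" "\<delta> \<le> \<rho>" "\<delta> < d" using \<open>\<rho> > 0\<close> d(1) by (auto simp: \<delta>_def)
  show thesis
  proof
    show "\<delta> > 0" by fact
    fix z z' assume z: "z \<in> K" "norm (z' - z) \<le> \<delta>"
    have near: "z' + h \<in> N" "z + h \<in> N" if "norm h \<le> \<rho>" for h
    proof -
      have "norm (z' + h - z) \<le> norm (z' - z) + norm h"
        using norm_triangle_ineq[of "z' - z" h] by (simp add: algebra_simps)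
      also have "\<dots> \<le> R" using that z(2) \<delta>(2) by (simp add: \<rho>_def)
      finally show "z' + h \<in> N" by (rule NI[OF z(1)])
      show "z + h \<in> N" using that R(1) by (intro NI[OF z(1)]) (simp add: \<rho>_def)
    qed
    have "z' \<in> N" using near(1)[of 0] \<open>\<rho> > 0\<close> by simp
    then show "z' \<in> D" using \<open>N \<subseteq> D\<close> by blast
    fix h
    have "norm (frechet_derivative f (at z') h - frechet_derivative f (at z) h)
        \<le> CARD('m) * \<kappa> / \<rho> * norm h"
    proof (rule frechet_derivative_diff_bound[OF f])
      show "cball z' \<rho> \<subseteq> D" "cball z \<rho> \<subseteq> D"
      proof -
        have "w \<in> N" if "w \<in> cball z' \<rho>" for w
          using near(1)[of "w - z'"] that by (simp add: dist_norm norm_minus_commute)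
        then show "cball z' \<rho> \<subseteq> D" using \<open>N \<subseteq> D\<close> by blast
        have "w \<in> N" if "w \<in> cball z \<rho>" for w
          using near(2)[of "w - z"] that by (simp add: dist_norm norm_minus_commute)
        then show "cball z \<rho> \<subseteq> D" using \<open>N \<subseteq> D\<close> by blast
      qed
      fix k :: "complex \<times> (complex^'n) \<times> complex" assume "norm k \<le> \<rho>"
      from d(2)[OF near(2,1)[OF this]] z(2) \<delta>
      show "norm (f (z' + k) - f (z + k)) \<le> \<kappa>" by (simp add: dist_norm)
    qed fact
    also have "CARD('m) * \<kappa> / \<rho> = \<eta>" using \<open>\<rho> > 0\<close> by (simp add: \<kappa>_def)
    finally show "norm (frechet_derivative f (at z') h - frechet_derivative f (at z) h) \<le> \<eta> * norm h" .
  qed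
qed

section \<open>Restriction to real arguments and linearization along a curve\<close>

definition Re_vec :: "complex^'n \<Rightarrow> real^'n" where
  "Re_vec z = (\<chi> k. Re (z $ k))"

lemma bounded_linear_Re_vec: "bounded_linear Re_vec"
  and norm_Re_vec_le: "norm (Re_vec z) \<le> norm z"
proof -
  show le: "norm (Re_vec z) \<le> norm z" for z :: "complex^'n"
    unfolding norm_vec_def Re_vec_def by (intro L2_set_mono) (auto intro: abs_Re_le_cmod)
  show "bounded_linear (Re_vec :: complex^'n \<Rightarrow> real^'n)"
    by (rule bounded_linear_intro[where K = 1]) (simp_all add: le, simp_all add: Re_vec_def vec_eq_iff)
qed

lemma norm_complex_vec: "norm (complex_vec x) = norm x"
  by (simp add: complex_vec_def norm_vec_def)

lemma bounded_linear_complex_vec: "bounded_linear complex_vec"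
  by (rule bounded_linear_intro[where K = 1])
    (simp_all add: norm_complex_vec, simp_all add: complex_vec_def vec_eq_iff scaleR_conv_of_real[where 'a = complex])

lemma complex_vec_diff: "complex_vec x - complex_vec y = complex_vec (x - y)"
  by (simp add: complex_vec_def vec_eq_iff)

lemma Re_vec_complex_vec: "Re_vec (complex_vec x) = x"
  by (simp add: Re_vec_def complex_vec_def)

lemma complex_vec_axis: "complex_vec (axis k 1) = axis k 1"
  by (simp add: complex_vec_def axis_def vec_eq_iff)

definition real_point :: "real \<Rightarrow> real^'n \<Rightarrow> real \<Rightarrow> complex \<times> (complex^'n) \<times> complex" where
  "real_point t x e = (complex_of_real t, complex_vec x, complex_of_real e)"

definition real_rhs ::
    "(complex \<times> (complex^'n) \<times> complex \<Rightarrow> complex^'m) \<Rightarrow> real \<Rightarrow> real^'n \<Rightarrow> real \<Rightarrow> real^'m" where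
  "real_rhs f t x e = Re_vec (f (real_point t x e))"

definition X_derivative ::
    "(complex \<times> (complex^'n) \<times> complex \<Rightarrow> complex^'m) \<Rightarrow> real \<Rightarrow> real^'n \<Rightarrow> real \<Rightarrow> real^'n \<Rightarrow> real^'m" where
  "X_derivative f t x e y = Re_vec (frechet_derivative f (at (real_point t x e)) (0, complex_vec y, 0))"

definition real_on_reals ::
    "(complex \<times> (complex^'n) \<times> complex \<Rightarrow> complex^'m) \<Rightarrow> (complex \<times> (complex^'n) \<times> complex) set \<Rightarrow> bool" where
  "real_on_reals f D \<longleftrightarrow> (\<forall>t x e. real_point t x e \<in> D \<longrightarrow> (\<exists>y. f (real_point t x e) = complex_vec y))"

lemma norm_real_point_diff_le:
  "norm (real_point t x e - real_point t' x' e') \<le> \<bar>t - t'\<bar> + norm (x - x') + \<bar>e - e'\<bar>"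
proof -
  have "norm (real_point t x e - real_point t' x' e') \<le>
      norm (complex_of_real t - of_real t') + norm (complex_vec x - complex_vec x', complex_of_real e - of_real e')"
    by (simp add: real_point_def norm_Pair_le)
  also have "norm (complex_vec x - complex_vec x', complex_of_real e - of_real e') \<le>
      norm (complex_vec x - complex_vec x') + norm (complex_of_real e - of_real e')"
    by (rule norm_Pair_le)
  finally show ?thesis
    by (simp add: complex_vec_diff norm_complex_vec flip: of_real_diff)
qed

lemma continuous_on_real_point:
  assumes "continuous_on S t" "continuous_on S x" "continuous_on S e"
  shows "continuous_on S (\<lambda>s. real_point (t s) (x s) (e s))"
  unfolding real_point_def
  by (intro continuous_intros bounded_linear.continuous_on[OF bounded_linear_complex_vec] assms)

lemma real_rhs_has_derivative:
  assumes "canalytic_on f D" "real_point t x e \<in> D"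
  shows "((\<lambda>y. real_rhs f t y e) has_derivative X_derivative f t x e) (at x)"
proof -
  have "((\<lambda>y. real_point t y e) has_derivative (\<lambda>h. (0, complex_vec h, 0))) (at x)"
    unfolding real_point_def
    by (intro has_derivative_Pair has_derivative_const
        bounded_linear_imp_has_derivative bounded_linear_complex_vec)
  from has_derivative_compose[OF this canalytic_on_frechet_derivative(1)[OF assms]]
  show ?thesis
    unfolding real_rhs_def X_derivative_def
    by (rule bounded_linear.has_derivative[OF bounded_linear_Re_vec])
qed

lemma linear_X_derivative:
  assumes "canalytic_on f D" "real_point t x e \<in> D"
  shows "linear (X_derivative f t x e)"
  using real_rhs_has_derivative[OF assms] by (rule has_derivative_linear)

text \<open>
  The derivative of a function that is real at real points is a limit of real difference
  quotients.
\<close>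

lemma X_derivative_real:
  assumes f: "canalytic_on f D" "open D" "real_point t x e \<in> D"
    and real: "real_on_reals f D"
  shows "frechet_derivative f (at (real_point t x e)) (0, complex_vec y, 0)
           = complex_vec (X_derivative f t x e y)"
proof -
  let ?f' = "frechet_derivative f (at (real_point t x e))"
  define p where "p s = real_point t (x + s *\<^sub>R y) e" for s
  have cv: "complex_vec (x + s *\<^sub>R y) = complex_vec x + s *\<^sub>R complex_vec y" for s
    by (simp add: linear_add linear_scale bounded_linear.linear[OF bounded_linear_complex_vec])
  have p': "(p has_derivative (\<lambda>s. s *\<^sub>R (0, complex_vec y, 0))) (at 0)"
    unfolding p_def real_point_def cv by (auto intro!: derivative_eq_intros)
  have p0: "p 0 = real_point t x e" by (simp add: p_def)
  have f'_p: "((\<lambda>s. f (p s)) has_derivative (\<lambda>s. ?f' (s *\<^sub>R (0, complex_vec y, 0)))) (at 0)"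
    by (rule has_derivative_compose[OF p'])
      (use canalytic_on_frechet_derivative(1)[OF f(1,3)] in \<open>simp add: p0\<close>)
  have "Im (?f' (0, complex_vec y, 0) $ k) = 0" for k
  proof -
    have Im': "((\<lambda>s. Im (f (p s) $ k)) has_derivative
        (\<lambda>s. Im (?f' (s *\<^sub>R (0, complex_vec y, 0)) $ k))) (at 0)"
      by (intro bounded_linear.has_derivative[OF bounded_linear_Im]
          bounded_linear.has_derivative[OF bounded_linear_vec_nth] f'_p)
    have "\<forall>\<^sub>F s in at 0. p s \<in> D"
      using has_derivative_continuous[OF p'] f(2,3)
      by (auto simp: continuous_within p0 intro: topological_tendstoD)
    then have "\<forall>\<^sub>F s in at 0. Im (f (p s) $ k) = 0"
    proof eventually_elim
      case (elim s)
      then obtain w where "f (p s) = complex_vec w" using real p_def unfolding real_on_reals_def by metis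
      then show ?case by (simp add: complex_vec_def)
    qed
    moreover obtain w where "f (real_point t x e) = complex_vec w"
      using real f(3) unfolding real_on_reals_def by blast
    then have "Im (f (p 0) $ k) = 0" by (simp add: p0 complex_vec_def)
    ultimately have "((\<lambda>s. 0) has_derivative
        (\<lambda>s. Im (?f' (s *\<^sub>R (0, complex_vec y, 0)) $ k))) (at (0::real))"
      by (intro has_derivative_transform_eventually[OF Im']) auto
    from has_derivative_unique[OF this has_derivative_const]
    have "Im (?f' (1 *\<^sub>R (0, complex_vec y, 0)) $ k) = 0" by metis
    then show ?thesis by simp
  qed
  then show ?thesis
    by (simp add: X_derivative_def Re_vec_def complex_vec_def vec_eq_iff complex_eq_iff)
qed

lemma jacobian_X_eq:
  assumes f: "canalytic_on f D" "open D" "real_point t x e \<in> D"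
    and real: "real_on_reals f D"
  shows "jacobian_X f (complex_of_real t) (complex_vec x) (complex_of_real e) $ j $ k
           = complex_of_real (matrix (X_derivative f t x e) $ j $ k)"
proof -
  let ?f' = "frechet_derivative f (at (real_point t x e))"
  have "((\<lambda>y. (complex_of_real t, y, complex_of_real e)) has_derivative (\<lambda>h. (0, h, 0)))
      (at (complex_vec x))"
    by (intro has_derivative_Pair has_derivative_const has_derivative_ident)
  from has_derivative_compose[OF this]
  have "((\<lambda>y. f (complex_of_real t, y, complex_of_real e)) has_derivative (\<lambda>h. ?f' (0, h, 0)))
      (at (complex_vec x))"
    using canalytic_on_frechet_derivative(1)[OF f(1,3)] by (simp add: real_point_def)
  note fd = frechet_derivative_at[OF this, symmetric]
  have "jacobian_X f (complex_of_real t) (complex_vec x) (complex_of_real e) $ j $ k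
      = ?f' (0, complex_vec (axis k 1), 0) $ j"
    unfolding jacobian_X_def jacobian_def fd matrix_def by (simp add: complex_vec_axis)
  also have "\<dots> = complex_vec (X_derivative f t x e (axis k 1)) $ j"
    by (rule arg_cong[OF X_derivative_real[OF f real]])
  also have "\<dots> = complex_of_real (matrix (X_derivative f t x e) $ j $ k)"
    by (simp add: complex_vec_def matrix_def)
  finally show ?thesis .
qed

text \<open>
  Taking imaginary and real parts of the characteristic equation: a non-real eigenvalue of a real
  \<open>2 \<times> 2\<close> matrix has half the trace as real part, and the discriminant is negative.
\<close>

lemma eigenvalue_real_matrix_2:
  fixes M :: "complex^2^2" and A :: "real^2^2"
  assumes M: "\<And>j k. M $ j $ k = complex_of_real (A $ j $ k)"
    and l: "l \<in> eigenvalues M" and "Im l \<noteq> 0"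
  shows "Re l = (A $ 1 $ 1 + A $ 2 $ 2) / 2"
    and "((A $ 1 $ 1 - A $ 2 $ 2) / 2)\<^sup>2 + A $ 1 $ 2 * A $ 2 $ 1 < 0"
proof -
  obtain v where v: "v \<noteq> 0" "M *v v = l *s v" using l unfolding eigenvalues_def by blast
  have 1: "M $ 1 $ 1 * v $ 1 + M $ 1 $ 2 * v $ 2 = l * v $ 1"
    and 2: "M $ 2 $ 1 * v $ 1 + M $ 2 $ 2 * v $ 2 = l * v $ 2"
    using v(2) by (simp_all add: vec_eq_iff matrix_vector_mult_def forall_2 sum_2)
  have "v $ 1 * ((M $ 1 $ 1 - l) * (M $ 2 $ 2 - l) - M $ 1 $ 2 * M $ 2 $ 1) = 0"
    "v $ 2 * ((M $ 1 $ 1 - l) * (M $ 2 $ 2 - l) - M $ 1 $ 2 * M $ 2 $ 1) = 0"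
    using 1 2 by algebra+
  moreover have "v $ 1 \<noteq> 0 \<or> v $ 2 \<noteq> 0" using v(1) by (auto simp: vec_eq_iff forall_2)
  ultimately have det: "(M $ 1 $ 1 - l) * (M $ 2 $ 2 - l) - M $ 1 $ 2 * M $ 2 $ 1 = 0"
    by auto
  have "Im l * (2 * Re l - (A $ 1 $ 1 + A $ 2 $ 2)) = 0"
    using arg_cong[OF det, of Im] by (simp add: M algebra_simps)
  with \<open>Im l \<noteq> 0\<close> show Re: "Re l = (A $ 1 $ 1 + A $ 2 $ 2) / 2" by simp
  have "(A $ 1 $ 1 - Re l) * (A $ 2 $ 2 - Re l) - (Im l)\<^sup>2 = A $ 1 $ 2 * A $ 2 $ 1"
    using arg_cong[OF det, of Re] by (simp add: M algebra_simps power2_eq_square)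
  then have "((A $ 1 $ 1 - A $ 2 $ 2) / 2)\<^sup>2 + A $ 1 $ 2 * A $ 2 $ 1 = - (Im l)\<^sup>2"
    unfolding Re by (simp add: field_simps power2_eq_square)
  with \<open>Im l \<noteq> 0\<close> show "((A $ 1 $ 1 - A $ 2 $ 2) / 2)\<^sup>2 + A $ 1 $ 2 * A $ 2 $ 1 < 0"
    by simp
qed

text \<open>
  Both parts express uniform continuity of the derivative near the compact curve: the matrix
  varies continuously, and, by the mean value inequality, the field differs from its linear part by a
  function with a small Lipschitz constant, uniformly in \<open>t\<close> and in the parameter.
\<close>

lemma linearization_along_curve:
  fixes f :: "complex \<times> (complex^'n) \<times> complex \<Rightarrow> complex^'m" and p :: "real \<Rightarrow> real^'n"
  assumes f: "canalytic_on f D" "open D"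
    and p: "continuous_on {c..d} p" "\<And>t. t \<in> {c..d} \<Longrightarrow> real_point t (p t) 0 \<in> D"
  shows continuous_on_X_derivative:
      "continuous_on {c..d} (\<lambda>t. matrix (X_derivative f t (p t) 0) $ j $ k)"
    and real_rhs_linearization: "0 < \<eta> \<Longrightarrow> \<exists>\<delta>>0. \<forall>t\<in>{c..d}. \<forall>x y e.
      norm (x - p t) \<le> \<delta> \<longrightarrow> norm (y - p t) \<le> \<delta> \<longrightarrow> \<bar>e\<bar> \<le> \<delta> \<longrightarrow>
        real_point t x e \<in> D \<and>
        norm (real_rhs f t x e - real_rhs f t y e - matrix (X_derivative f t (p t) 0) *v (x - y))
          \<le> \<eta> * norm (x - y)"
proof -
  let ?K = "(\<lambda>t. real_point t (p t) 0) ` {c..d}"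
  have cont: "continuous_on {c..d} (\<lambda>t. real_point t (p t) 0)"
    by (intro continuous_on_real_point continuous_intros p)
  then have K: "compact ?K" "?K \<subseteq> D"
    using p(2) by (auto intro: compact_continuous_image)
  have near: "\<exists>\<delta>>0. \<forall>z\<in>?K. \<forall>z'. norm (z' - z) \<le> \<delta> \<longrightarrow> z' \<in> D \<and>
      (\<forall>h. norm (frechet_derivative f (at z') h - frechet_derivative f (at z) h) \<le> \<eta> * norm h)"
    if "0 < \<eta>" for \<eta> :: real
    by (rule frechet_derivative_uniformly_continuous_near_compact[OF f K that]) blast
  have norm_h: "norm (0::complex, complex_vec y, 0::complex) = norm y" for y :: "real^'n"
    by (simp add: norm_Pair norm_complex_vec)
  have diff: "norm (X_derivative f t x e y - X_derivative f t' x' e' y) \<le>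
      norm (frechet_derivative f (at (real_point t x e)) (0, complex_vec y, 0)
        - frechet_derivative f (at (real_point t' x' e')) (0, complex_vec y, 0))"
    for t t' e e' :: real and x x' y :: "real^'n"
    unfolding X_derivative_def linear_diff[OF bounded_linear.linear[OF bounded_linear_Re_vec], symmetric]
    by (rule norm_Re_vec_le)
  show "continuous_on {c..d} (\<lambda>t. matrix (X_derivative f t (p t) 0) $ j $ k)"
    unfolding continuous_on_iff
  proof (intro ballI allI impI)
    fix t and \<eta> :: real assume t: "t \<in> {c..d}" and "0 < \<eta>"
    then have "0 < \<eta> / 2" by simp
    from near[OF this] obtain \<delta> where \<delta>: "\<delta> > 0"
      "\<And>z z' h. z \<in> ?K \<Longrightarrow> norm (z' - z) \<le> \<delta> \<Longrightarrow>
        norm (frechet_derivative f (at z') h - frechet_derivative f (at z) h) \<le> \<eta> / 2 * norm h"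
      by blast
    obtain r where r: "r > 0"
      "\<And>s. s \<in> {c..d} \<Longrightarrow> dist s t < r \<Longrightarrow> dist (real_point s (p s) 0) (real_point t (p t) 0) < \<delta>"
      using cont \<delta>(1) t unfolding continuous_on_iff by meson
    have "dist (matrix (X_derivative f s (p s) 0) $ j $ k) (matrix (X_derivative f t (p t) 0) $ j $ k) < \<eta>"
      if s: "s \<in> {c..d}" "dist s t < r" for s
    proof -
      have "dist (matrix (X_derivative f s (p s) 0) $ j $ k) (matrix (X_derivative f t (p t) 0) $ j $ k)
          = norm ((X_derivative f s (p s) 0 (axis k 1) - X_derivative f t (p t) 0 (axis k 1)) $ j)"
        by (simp add: matrix_def dist_norm)
      also have "\<dots> \<le> norm (X_derivative f s (p s) 0 (axis k 1) - X_derivative f t (p t) 0 (axis k 1))"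
        by (rule Finite_Cartesian_Product.norm_nth_le)
      also have "\<dots> \<le> \<eta> / 2 * norm (axis k (1::real))"
        by (rule order_trans[OF diff], subst norm_h[symmetric], rule \<delta>(2))
          (use r(2)[OF s] t in \<open>auto simp: dist_norm\<close>)
      finally show ?thesis using \<open>0 < \<eta>\<close> by simp
    qed
    then show "\<exists>r>0. \<forall>s\<in>{c..d}. dist s t < r \<longrightarrow>
        dist (matrix (X_derivative f s (p s) 0) $ j $ k) (matrix (X_derivative f t (p t) 0) $ j $ k) < \<eta>"
      using r(1) by blast
  qed
  assume "0 < \<eta>"
  from near[OF this] obtain \<delta> where \<delta>: "\<delta> > 0"
    "\<And>z z'. z \<in> ?K \<Longrightarrow> norm (z' - z) \<le> \<delta> \<Longrightarrow> z' \<in> D"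
    "\<And>z z' h. z \<in> ?K \<Longrightarrow> norm (z' - z) \<le> \<delta> \<Longrightarrow>
      norm (frechet_derivative f (at z') h - frechet_derivative f (at z) h) \<le> \<eta> * norm h"
    by blast
  have main: "real_point t x e \<in> D \<and>
        norm (real_rhs f t x e - real_rhs f t y e - matrix (X_derivative f t (p t) 0) *v (x - y))
          \<le> \<eta> * norm (x - y)"
    if t: "t \<in> {c..d}" and xye: "norm (x - p t) \<le> \<delta> / 2" "norm (y - p t) \<le> \<delta> / 2" "\<bar>e\<bar> \<le> \<delta> / 2"
    for t x y e
  proof -
    let ?L = "X_derivative f t (p t) 0"
    have "linear ?L" by (rule linear_X_derivative[OF f(1) p(2)[OF t]])
    have close: "norm (real_point t w e - real_point t (p t) 0) \<le> \<delta>" if "w \<in> cball (p t) (\<delta> / 2)" for w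
      using norm_real_point_diff_le[of t w e t "p t" 0] that xye(3)
      by (simp add: dist_norm norm_minus_commute)
    have inD: "real_point t w e \<in> D" if "w \<in> cball (p t) (\<delta> / 2)" for w
      using \<delta>(2)[OF _ close[OF that]] t by blast
    have "norm ((real_rhs f t x e - ?L x) - (real_rhs f t y e - ?L y)) \<le> \<eta> * norm (x - y)"
    proof (rule differentiable_bound[where S = "cball (p t) (\<delta> / 2)"])
      fix w assume w: "w \<in> cball (p t) (\<delta> / 2)"
      show "((\<lambda>w. real_rhs f t w e - ?L w) has_derivative (\<lambda>h. X_derivative f t w e h - ?L h))
          (at w within cball (p t) (\<delta> / 2))"
        by (intro has_derivative_diff has_derivative_at_withinI[OF real_rhs_has_derivative[OF f(1) inD[OF w]]]
            linear_imp_has_derivative \<open>linear ?L\<close>)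
      show "onorm (\<lambda>h. X_derivative f t w e h - ?L h) \<le> \<eta>"
      proof (rule onorm_bound)
        fix h
        show "norm (X_derivative f t w e h - ?L h) \<le> \<eta> * norm h"
          by (rule order_trans[OF diff], subst norm_h[symmetric], rule \<delta>(3))
            (use close[OF w] t in auto)
      qed (use \<open>0 < \<eta>\<close> in simp)
    qed (use xye in \<open>auto simp: dist_norm norm_minus_commute\<close>)
    moreover have "real_rhs f t x e - real_rhs f t y e - matrix ?L *v (x - y)
        = (real_rhs f t x e - ?L x) - (real_rhs f t y e - ?L y)"
      using \<open>linear ?L\<close> by (simp add: matrix_works linear_diff)
    ultimately have "norm (real_rhs f t x e - real_rhs f t y e - matrix ?L *v (x - y)) \<le> \<eta> * norm (x - y)"
      by (simp only:)
    moreover have "real_point t x e \<in> D"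
      using xye(1) by (intro inD) (simp add: dist_norm norm_minus_commute)
    ultimately show ?thesis by blast
  qed
  show "\<exists>\<delta>>0. \<forall>t\<in>{c..d}. \<forall>x y e.
      norm (x - p t) \<le> \<delta> \<longrightarrow> norm (y - p t) \<le> \<delta> \<longrightarrow> \<bar>e\<bar> \<le> \<delta> \<longrightarrow>
        real_point t x e \<in> D \<and>
        norm (real_rhs f t x e - real_rhs f t y e - matrix (X_derivative f t (p t) 0) *v (x - y))
          \<le> \<eta> * norm (x - y)"
    using main \<delta>(1) by (intro exI[of _ "\<delta> / 2"]) auto
qed

section \<open>Local existence for ordinary differential equations\<close>

text \<open>
  Banach's fixed point theorem for the integral operator. Time runs only to the right of \<open>b\<close>, which
  suits the continuation of a solution beyond the right end of its interval.
\<close>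

lemma picard_lindelof_right:
  fixes g :: "real \<Rightarrow> 'a::euclidean_space \<Rightarrow> 'a"
  assumes "0 < r"
    and cont: "continuous_on ({b..b + r} \<times> cball w r) (\<lambda>(t, x). g t x)"
    and lip: "\<And>t x y. t \<in> {b..b + r} \<Longrightarrow> x \<in> cball w r \<Longrightarrow> y \<in> cball w r \<Longrightarrow>
      norm (g t x - g t y) \<le> L * norm (x - y)"
  obtains h v where "0 < h" "h \<le> r" "continuous_on {b..b + h} v"
    "\<And>t. t \<in> {b..b + h} \<Longrightarrow> v t \<in> cball w r"
    "\<And>t. t \<in> {b..b + h} \<Longrightarrow> v t = w + integral {b..t} (\<lambda>s. g s (v s))"
proof -
  have "compact ((\<lambda>(t, x). g t x) ` ({b..b + r} \<times> cball w r))"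
    by (intro compact_continuous_image cont compact_Times compact_Icc compact_cball)
  from compact_imp_bounded[OF this] obtain M where
    M: "M > 0" "\<And>t x. t \<in> {b..b + r} \<Longrightarrow> x \<in> cball w r \<Longrightarrow> norm (g t x) \<le> M"
    unfolding bounded_pos by force
  \<comment> \<open>The bound \<open>r / M\<close> keeps the iterates in the ball, the other one makes the operator contract by \<open>1/2\<close>.\<close>
  define h where "h = min r (min (r / M) (1 / (2 * (\<bar>L\<bar> + 1))))"
  have h: "0 < h" "h \<le> r" "h * M \<le> r" "h * \<bar>L\<bar> \<le> 1 / 2"
  proof -
    show "0 < h" "h \<le> r" using \<open>0 < r\<close> M(1) by (auto simp: h_def)
    have "h \<le> r / M" by (simp add: h_def)
    then show "h * M \<le> r" using M(1) by (simp add: field_simps)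
    have "h \<le> 1 / (2 * (\<bar>L\<bar> + 1))" by (simp add: h_def)
    then have "h * (2 * (\<bar>L\<bar> + 1)) \<le> 1" by (simp add: field_simps)
    with \<open>0 < h\<close> show "h * \<bar>L\<bar> \<le> 1 / 2" by (simp add: algebra_simps)
  qed
  \<comment> \<open>Composing with the nearest-point projection to the ball and with the truncation of time
    makes the right-hand side globally defined, bounded and Lipschitz.\<close>
  define P where "P = closest_point (cball w r)"
  have P: "P x \<in> cball w r" "dist (P x) (P y) \<le> dist x y" for x y
    unfolding P_def using \<open>0 < r\<close>
    by (auto intro!: closest_point_in_set closest_point_lipschitz simp del: mem_cball)
  have P_id: "P x = x" if "x \<in> cball w r" for x
    unfolding P_def using that by (rule closest_point_self)
  have contP: "continuous_on S P" for S
    by (rule continuous_on_subset[OF lipschitz_on_continuous_on[of 1 UNIV]])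
      (auto intro!: lipschitz_onI P)
  define G where "G u t = w + integral {b..t} (\<lambda>s. g s (P (u s)))" for u t
  define c where "c t = max b (min t (b + h))" for t
  have c: "c t \<in> {b..b + h}" "t \<in> {b..b + h} \<Longrightarrow> c t = t" for t
    using h(1) by (auto simp: c_def)
  have cont_int: "continuous_on {b..b + h} (\<lambda>s. g s (P (u s)))" if "continuous_on UNIV u" for u
  proof -
    have "continuous_on {b..b + h} (\<lambda>s. (\<lambda>(t, x). g t x) (s, P (u s)))"
      by (rule continuous_on_compose2[OF cont])
        (use h(2) P(1) in \<open>auto intro!: continuous_intros continuous_on_compose2[OF contP]
           continuous_on_subset[OF that]\<close>)
    then show ?thesis by simp
  qed
  have int: "(\<lambda>s. g s (P (u s))) integrable_on {b..t}"
    if "continuous_on UNIV u" "t \<in> {b..b + h}" for u t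
    by (rule integrable_continuous_real, rule continuous_on_subset[OF cont_int[OF that(1)]])
      (use that in auto)
  have G_bound: "norm (G u t - w) \<le> r" if "continuous_on UNIV u" "t \<in> {b..b + h}" for u t
  proof -
    have "norm (integral {b..t} (\<lambda>s. g s (P (u s)))) \<le> M * (t - b)"
      by (rule integral_bound)
        (use that h(2) P(1) in \<open>auto intro!: M(2) continuous_on_subset[OF cont_int[OF that(1)]]\<close>)
    also have "\<dots> \<le> M * h" using that(2) M(1) by (intro mult_left_mono) auto
    finally show ?thesis using h(3) by (simp add: G_def mult.commute)
  qed
  have G_cont: "continuous_on UNIV (\<lambda>t. G u (c t))" if "continuous_on UNIV u" for u
  proof -
    have "continuous_on {b..b + h} (G u)"
      unfolding G_def
      by (intro continuous_intros indefinite_integral_continuous_1 int[OF that]) (use h(1) in auto)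
    moreover have "continuous_on UNIV c" unfolding c_def by (intro continuous_intros)
    ultimately show ?thesis
      by (rule continuous_on_compose2) (use c in auto)
  qed
  define T where "T u = Bcontfun (\<lambda>t. G (apply_bcontfun u) (c t))" for u
  have cu: "continuous_on UNIV (apply_bcontfun u)" for u :: "real \<Rightarrow>\<^sub>C 'a"
    by (rule continuous_on_apply_bcontfun)
  have T: "apply_bcontfun (T u) t = G (apply_bcontfun u) (c t)" for u t
  proof -
    have "(\<lambda>t. G (apply_bcontfun u) (c t)) \<in> bcontfun"
    proof (rule bcontfun_normI[OF G_cont[OF cu], of _ "norm w + r"])
      fix t show "norm (G (apply_bcontfun u) (c t)) \<le> norm w + r"
        using G_bound[OF cu c(1)] norm_triangle_ineq2 by (smt (verit))
    qed
    then show ?thesis unfolding T_def by (simp add: Bcontfun_inverse)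
  qed
  have "dist (T u) (T v) \<le> 1 / 2 * dist u v" for u v
  proof (rule dist_bound)
    fix t
    let ?d = "\<lambda>s. g s (P (apply_bcontfun u s)) - g s (P (apply_bcontfun v s))"
    have "dist (apply_bcontfun (T u) t) (apply_bcontfun (T v) t) = norm (integral {b..c t} ?d)"
      using int[OF cu c(1)] by (simp add: T G_def dist_norm integral_diff)
    also have "\<dots> \<le> (\<bar>L\<bar> * dist u v) * (c t - b)"
    proof (rule integral_bound)
      show "continuous_on {b..c t} ?d"
        by (rule continuous_on_subset[of "{b..b + h}"]) (use c(1)[of t] in \<open>auto intro!: continuous_intros cont_int\<close>)
      fix s assume s: "s \<in> {b..c t}"
      have "norm (?d s) \<le> L * norm (P (apply_bcontfun u s) - P (apply_bcontfun v s))"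
        using s c(1)[of t] h(2) by (intro lip P) auto
      also have "\<dots> \<le> \<bar>L\<bar> * dist u v"
        using P(2)[of "apply_bcontfun u s" "apply_bcontfun v s"] dist_bounded[of u s v]
        by (intro mult_mono) (auto simp: dist_norm)
      finally show "norm (?d s) \<le> \<bar>L\<bar> * dist u v" .
    qed (use c(1)[of t] in auto)
    also have "\<dots> \<le> (\<bar>L\<bar> * dist u v) * h"
      using c(1)[of t] by (intro mult_left_mono) auto
    also have "\<dots> \<le> 1 / 2 * dist u v"
      using mult_right_mono[OF h(4), of "dist u v"] by (simp add: mult_ac)
    finally show "dist (apply_bcontfun (T u) t) (apply_bcontfun (T v) t) \<le> 1 / 2 * dist u v" .
  qed
  then obtain u where u: "T u = u"
    using banach_fix_type[of "1/2" T] by auto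
  let ?v = "apply_bcontfun u"
  have eq: "?v t = G ?v t" if "t \<in> {b..b + h}" for t
    using T[of u t] u c(2)[OF that] by simp
  have ball: "?v t \<in> cball w r" if "t \<in> {b..b + h}" for t
    using G_bound[OF cu that] eq[OF that] by (simp add: dist_norm norm_minus_commute)
  show thesis
  proof (rule that[OF h(1,2)])
    show "continuous_on {b..b + h} ?v" by (rule continuous_on_apply_bcontfun)
    fix t assume t: "t \<in> {b..b + h}"
    show "?v t \<in> cball w r" using ball[OF t] .
    have "integral {b..t} (\<lambda>s. g s (P (?v s))) = integral {b..t} (\<lambda>s. g s (?v s))"
      by (rule integral_cong) (use t ball P_id in auto)
    with eq[OF t] show "?v t = w + integral {b..t} (\<lambda>s. g s (?v s))"
      by (simp add: G_def)
  qed
qed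

section \<open>Continuation of maximal solutions in a tube\<close>

definition ode_solution ::
    "(real \<times> 'a::euclidean_space) set \<Rightarrow> (real \<Rightarrow> 'a \<Rightarrow> 'a) \<Rightarrow> real set \<Rightarrow> (real \<Rightarrow> 'a) \<Rightarrow> bool" where
  "ode_solution W g J u \<longleftrightarrow> J \<noteq> {} \<and> open J \<and> is_interval J \<and>
     (\<forall>t\<in>J. (t, u t) \<in> W \<and> (u has_vector_derivative g t (u t)) (at t))"

definition maximal_ode_solution ::
    "(real \<times> 'a::euclidean_space) set \<Rightarrow> (real \<Rightarrow> 'a \<Rightarrow> 'a) \<Rightarrow> real set \<Rightarrow> (real \<Rightarrow> 'a) \<Rightarrow> bool" where
  "maximal_ode_solution W g J u \<longleftrightarrow> ode_solution W g J u \<and>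
     (\<forall>J' u'. ode_solution W g J' u' \<and> J \<subseteq> J' \<and> (\<forall>t\<in>J. u' t = u t) \<longrightarrow> J' = J)"

definition tube :: "real set \<Rightarrow> (real \<Rightarrow> 'a::euclidean_space) \<Rightarrow> real \<Rightarrow> (real \<times> 'a) set" where
  "tube I p \<delta> = {(t, x). t \<in> I \<and> norm (x - p t) \<le> \<delta>}"

text \<open>
  The requirements of the existence theorem, on a whole neighbourhood of a curve.
\<close>

definition tame_on_tube ::
    "(real \<times> 'a::euclidean_space) set \<Rightarrow> (real \<Rightarrow> 'a \<Rightarrow> 'a) \<Rightarrow> real set \<Rightarrow> (real \<Rightarrow> 'a) \<Rightarrow> real \<Rightarrow> bool" where
  "tame_on_tube W g I p \<delta> \<longleftrightarrow> continuous_on I p \<and> tube I p \<delta> \<subseteq> W \<and>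
     continuous_on (tube I p \<delta>) (\<lambda>(t, x). g t x) \<and>
     (\<exists>L. \<forall>t x y. (t, x) \<in> tube I p \<delta> \<longrightarrow> (t, y) \<in> tube I p \<delta> \<longrightarrow>
        norm (g t x - g t y) \<le> L * norm (x - y))"

lemma ode_solution_continuous_on:
  assumes "ode_solution W g J u" shows "continuous_on J u"
  using assms unfolding ode_solution_def
  by (auto intro!: continuous_at_imp_continuous_on has_vector_derivative_continuous)

lemma compact_tube:
  assumes "compact I" "continuous_on I p"
  shows "compact (tube I p \<delta>)"
proof -
  have "tube I p \<delta> = (\<lambda>(t, y). (t, p t + y)) ` (I \<times> cball 0 \<delta>)"
  proof (intro set_eqI iffI)
    fix z assume "z \<in> tube I p \<delta>"
    then show "z \<in> (\<lambda>(t, y). (t, p t + y)) ` (I \<times> cball 0 \<delta>)"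
      by (intro image_eqI[of _ _ "(fst z, snd z - p (fst z))"]) (auto simp: tube_def dist_norm norm_minus_commute)
  qed (auto simp: tube_def dist_norm)
  moreover have "continuous_on (I \<times> cball 0 \<delta>) (\<lambda>(t, y). (t, p t + y))"
    unfolding case_prod_unfold
    by (intro continuous_intros continuous_on_compose2[OF assms(2)]) auto
  ultimately show ?thesis
    using assms(1) by (simp add: compact_continuous_image compact_Times)
qed

text \<open>
  In the tube the field is bounded, so a solution is Lipschitz and has a limit at the end of its
  interval.
\<close>

lemma ode_solution_closes_up:
  assumes u: "\<And>t. t \<in> {t1..<b} \<Longrightarrow> (u has_vector_derivative g t (u t)) (at t)" and "t1 < b"
    and tame: "tame_on_tube W g {c..d} p \<delta>" and "{t1..<b} \<subseteq> {c..d}" "b \<in> {c..d}"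
    and in_tube: "\<And>t. t \<in> {t1..<b} \<Longrightarrow> norm (u t - p t) \<le> \<delta>'" "\<delta>' \<le> \<delta>"
  obtains z where "continuous_on {t1..b} z" "\<And>t. t \<in> {t1..<b} \<Longrightarrow> z t = u t"
    "norm (z b - p b) \<le> \<delta>'"
proof -
  have "compact (tube {c..d} p \<delta>)"
    using tame by (intro compact_tube) (auto simp: tame_on_tube_def)
  then have "compact ((\<lambda>(t, x). g t x) ` tube {c..d} p \<delta>)"
    using tame by (intro compact_continuous_image) (auto simp: tame_on_tube_def)
  from compact_imp_bounded[OF this] obtain M where
    M: "M > 0" "\<And>t x. (t, x) \<in> tube {c..d} p \<delta> \<Longrightarrow> norm (g t x) \<le> M"
    unfolding bounded_pos by force
  have "norm (g t (u t)) \<le> M" if "t \<in> {t1..<b}" for t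
    using in_tube(1)[OF that] in_tube(2) subsetD[OF assms(4) that] by (intro M(2)) (simp add: tube_def)
  then have bound: "onorm (\<lambda>h. h *\<^sub>R g t (u t)) \<le> M" if "t \<in> {t1..<b}" for t
    using onorm_scaleR_left[OF bounded_linear_ident, of "g t (u t)"] that by (simp add: onorm_id)
  have deriv: "(u has_derivative (\<lambda>h. h *\<^sub>R g t (u t))) (at t within {t1..<b})"
    if "t \<in> {t1..<b}" for t
    using u[OF that] unfolding has_vector_derivative_def by (rule has_derivative_at_withinI)
  have "norm (u s - u t) \<le> M * norm (s - t)" if "s \<in> {t1..<b}" "t \<in> {t1..<b}" for s t
    by (rule differentiable_bound[OF convex_real_interval(7) deriv bound that])
  then have "M-lipschitz_on {t1..<b} u"
    using M(1) by (intro lipschitz_onI) (auto simp: dist_norm)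
  then have "uniformly_continuous_on {t1..<b} u" by (rule lipschitz_on_uniformly_continuous)
  from uniformly_continuous_on_extension_on_closure[OF this] obtain z where
    z: "uniformly_continuous_on (closure {t1..<b}) z" "\<And>t. t \<in> {t1..<b} \<Longrightarrow> u t = z t" by metis
  have clo: "closure {t1..<b} = {t1..b}" using \<open>t1 < b\<close> by simp
  have cz: "continuous_on {t1..b} z" using z(1) unfolding clo by (rule uniformly_continuous_imp_continuous)
  have "norm (z b - p b) \<le> \<delta>'"
  proof (rule continuous_le_on_closure[of "{t1..<b}" "\<lambda>t. norm (z t - p t)"])
    have "{t1..b} \<subseteq> {c..d}" using assms(4,5) \<open>t1 < b\<close> by auto
    then show "continuous_on (closure {t1..<b}) (\<lambda>t. norm (z t - p t))"
      unfolding clo using tame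
      by (intro continuous_intros cz) (auto simp: tame_on_tube_def intro: continuous_on_subset)
    show "norm (z t - p t) \<le> \<delta>'" if "t \<in> {t1..<b}" for t using in_tube(1)[OF that] z(2)[OF that] by simp
  qed (use clo \<open>t1 < b\<close> in auto)
  with that[OF cz] z(2) show thesis by simp
qed

text \<open>
  The limit at \<open>b\<close> is an inner point of the tube, so a solution starts there. The old and the new
  piece are joined in the integral equation, which takes care of the derivative at \<open>b\<close>.
\<close>

lemma ode_solution_extends_in_tube:
  assumes u: "ode_solution W g J u" and t1: "{t1..<b} \<subseteq> J" "t1 < b" "b \<notin> J"
    and tame: "tame_on_tube W g {c..d} p \<delta>" and "c \<le> t1" "b < d"
    and in_tube: "\<And>t. t \<in> {t1..<b} \<Longrightarrow> norm (u t - p t) \<le> \<delta>'" "\<delta>' < \<delta>"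
  shows "\<exists>J' u'. ode_solution W g J' u' \<and> J \<subseteq> J' \<and> (\<forall>t\<in>J. u' t = u t) \<and> b \<in> J'"
proof -
  have u': "(u has_vector_derivative g t (u t)) (at t)" if "t \<in> {t1..<b}" for t
    using u t1(1) that by (auto simp: ode_solution_def)
  have sub: "{t1..<b} \<subseteq> {c..d}" "b \<in> {c..d}" using assms(6,7) t1(2) by auto
  obtain z where z: "continuous_on {t1..b} z" "\<And>t. t \<in> {t1..<b} \<Longrightarrow> z t = u t"
    "norm (z b - p b) \<le> \<delta>'"
    by (rule ode_solution_closes_up[OF u' t1(2) tame sub in_tube(1) less_imp_le[OF in_tube(2)]]) blast+
  have cp: "continuous_on {c..d} p"
    and cg: "continuous_on (tube {c..d} p \<delta>) (\<lambda>(t, x). g t x)"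
    and W: "tube {c..d} p \<delta> \<subseteq> W"
    using tame by (auto simp: tame_on_tube_def)
  obtain L where L: "\<And>t x y. (t, x) \<in> tube {c..d} p \<delta> \<Longrightarrow> (t, y) \<in> tube {c..d} p \<delta> \<Longrightarrow>
      norm (g t x - g t y) \<le> L * norm (x - y)"
    using tame unfolding tame_on_tube_def by blast
  define \<theta> where "\<theta> = (\<delta> - \<delta>') / 2"
  have "0 < \<theta>" using in_tube(2) by (simp add: \<theta>_def)
  then obtain r0 where r0: "r0 > 0" "\<And>t. t \<in> {c..d} \<Longrightarrow> dist t b < r0 \<Longrightarrow> dist (p t) (p b) < \<theta>"
    using cp sub(2) unfolding continuous_on_iff by meson
  define r where "r = min (r0 / 2) (min \<theta> (d - b))"
  have r: "0 < r" "r < r0" "r \<le> \<theta>" "b + r \<le> d"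
    using r0(1) \<open>0 < \<theta>\<close> \<open>b < d\<close> by (auto simp: r_def)
  have box: "(t, x) \<in> tube {c..d} p \<delta>" if "t \<in> {b..b + r}" "x \<in> cball (z b) r" for t x
  proof -
    have t: "t \<in> {c..d}" using that(1) r assms(6) t1(2) by auto
    have "norm (p t - p b) < \<theta>" using r0(2)[OF t] that(1) r by (auto simp: dist_norm)
    moreover have "norm (x - z b) \<le> \<theta>" using that(2) r(3) by (simp add: dist_norm norm_minus_commute)
    moreover have "norm (x - p t) \<le> norm (x - z b) + norm (z b - p b) + norm (p t - p b)"
      using norm_triangle_ineq[of "x - z b" "z b - p t"] norm_triangle_ineq4[of "z b - p b" "p t - p b"]
      by (simp add: algebra_simps)
    ultimately show ?thesis using z(3) t by (simp add: tube_def \<theta>_def)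
  qed
  have cont_box: "continuous_on ({b..b + r} \<times> cball (z b) r) (\<lambda>(t, x). g t x)"
    using box by (intro continuous_on_subset[OF cg]) auto
  obtain h v where h: "0 < h" "h \<le> r" and v: "continuous_on {b..b + h} v"
    "\<And>t. t \<in> {b..b + h} \<Longrightarrow> v t \<in> cball (z b) r"
    "\<And>t. t \<in> {b..b + h} \<Longrightarrow> v t = z b + integral {b..t} (\<lambda>s. g s (v s))"
    by (rule picard_lindelof_right[OF r(1) cont_box L[OF box box]]) blast+
  \<comment> \<open>On \<open>{t1..b + h}\<close> the function \<open>y\<close> solves the integral equation, hence the differential equation.\<close>
  define y where "y t = (if t \<le> b then z t else v t)" for t
  have vb: "v b = z b" using v(3)[of b] h(1) by simp
  have yu: "y t = u t" if "t \<in> {t1..<b}" for t using that z(2) by (simp add: y_def)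
  have yv: "y t = v t" if "t \<ge> b" for t using that vb by (simp add: y_def)
  have cy: "continuous_on {t1..b + h} y"
  proof -
    have "{t1..b + h} = {t1..b} \<union> {b..b + h}" using t1(2) h(1) by auto
    then show ?thesis unfolding y_def using z(1) v(1) vb
      by (auto intro!: continuous_on_If)
  qed
  have y_tube: "(t, y t) \<in> tube {c..d} p \<delta>" if "t \<in> {t1..b + h}" for t
  proof (cases "t < b")
    case True
    then show ?thesis using in_tube(1)[of t] in_tube(2) yu[of t] that assms(6,7) by (simp add: tube_def)
  next
    case False
    then show ?thesis using box[of t "v t"] v(2)[of t] yv[of t] that h by simp
  qed
  have cgy: "continuous_on {t1..b + h} (\<lambda>s. g s (y s))"
  proof -
    have "continuous_on {t1..b + h} (\<lambda>s. (\<lambda>(t, x). g t x) (s, y s))"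
      by (rule continuous_on_compose2[OF cg]) (use y_tube in \<open>auto intro!: continuous_intros cy\<close>)
    then show ?thesis by simp
  qed
  have before: "((\<lambda>s. g s (y s)) has_integral y t - y t1) {t1..t}" if t: "t \<in> {t1..b}" for t
  proof (rule fundamental_theorem_of_calculus_interior)
    show "continuous_on {t1..t} y" by (rule continuous_on_subset[OF cy]) (use t h(1) in auto)
    fix s assume s: "s \<in> {t1<..<t}"
    show "(y has_vector_derivative g s (y s)) (at s)"
      by (rule has_vector_derivative_transform_within_open[of u _ _ "{t1<..<t}"])
        (use s t u'[of s] yu in auto)
  qed (use t in auto)
  have integral_eq: "y t = y t1 + integral {t1..t} (\<lambda>s. g s (y s))" if t: "t \<in> {t1..b + h}" for t
  proof (cases "t \<le> b")
    case True
    then show ?thesis using integral_unique[OF before[of t]] t by simp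
  next
    case False
    have "integral {t1..b} (\<lambda>s. g s (y s)) + integral {b..t} (\<lambda>s. g s (y s))
        = integral {t1..t} (\<lambda>s. g s (y s))"
      by (rule Henstock_Kurzweil_Integration.integral_combine)
        (use False t t1(2) in \<open>auto intro!: integrable_continuous_real continuous_on_subset[OF cgy]\<close>)
    moreover have "integral {b..t} (\<lambda>s. g s (y s)) = integral {b..t} (\<lambda>s. g s (v s))"
      by (rule integral_cong) (use yv in auto)
    moreover have "v t = z b + integral {b..t} (\<lambda>s. g s (v s))" using v(3)[of t] t False by simp
    moreover have "integral {t1..b} (\<lambda>s. g s (y s)) = y b - y t1"
      using integral_unique[OF before[of b]] t1(2) by simp
    ultimately show ?thesis using yv[of t] yv[of b] vb False by (simp add: algebra_simps)
  qed
  have y': "(y has_vector_derivative g t (y t)) (at t)" if t: "t \<in> {t1<..<b + h}" for t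
  proof -
    have "((\<lambda>t. integral {t1..t} (\<lambda>s. g s (y s))) has_vector_derivative g t (y t)) (at t within {t1..b + h})"
      by (rule integral_has_vector_derivative[OF cgy]) (use t in auto)
    then have "((\<lambda>t. y t1 + integral {t1..t} (\<lambda>s. g s (y s))) has_vector_derivative 0 + g t (y t))
        (at t within {t1..b + h})"
      by (intro has_vector_derivative_add has_vector_derivative_const)
    then have "((\<lambda>t. y t1 + integral {t1..t} (\<lambda>s. g s (y s))) has_vector_derivative g t (y t)) (at t)"
      using t at_within_Icc_at[of t1 t "b + h"] by simp
    then show ?thesis
      by (rule has_vector_derivative_transform_within_open[of _ _ _ "{t1<..<b + h}"])
        (use t integral_eq[symmetric] in auto)
  qed
  define J' where "J' = J \<union> {t1<..<b + h}"
  define w where "w t = (if t < b then u t else v t)" for t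
  have Jb: "t < b" if "t \<in> J" for t
  proof (rule ccontr)
    assume "\<not> t < b"
    moreover have "t1 \<in> J" using t1 by auto
    ultimately have "b \<in> J"
      using u that t1(2) mem_is_interval_1_I[of J t1 t b] by (simp add: ode_solution_def)
    with t1(3) show False by simp
  qed
  have wy: "w t = y t" if "t \<in> {t1<..<b + h}" for t
    using that yu[of t] yv[of t] by (auto simp: w_def)
  have sol: "ode_solution W g J' w"
    unfolding ode_solution_def
  proof (intro conjI ballI)
    show "J' \<noteq> {}" "open J'" using u by (auto simp: ode_solution_def J'_def)
    have "connected J'"
      unfolding J'_def
    proof (rule connected_Un)
      show "connected J" using u by (simp add: ode_solution_def is_interval_connected_1)
      have "(t1 + b) / 2 \<in> J \<inter> {t1<..<b + h}" using t1 h(1) by auto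
      then show "J \<inter> {t1<..<b + h} \<noteq> {}" by blast
    qed auto
    then show "is_interval J'" by (simp add: is_interval_connected_1)
    fix t assume "t \<in> J'"
    then consider "t \<in> J" | "t \<in> {t1<..<b + h}" unfolding J'_def by blast
    then have "(t, w t) \<in> W \<and> (w has_vector_derivative g t (w t)) (at t)"
    proof cases
      case 1
      then have "w t = u t" using Jb by (simp add: w_def)
      moreover have "(w has_vector_derivative g t (u t)) (at t)"
        by (rule has_vector_derivative_transform_within_open[of u _ _ J])
          (use 1 u Jb in \<open>auto simp: ode_solution_def w_def\<close>)
      ultimately show ?thesis using u 1 by (simp add: ode_solution_def)
    next
      case 2
      moreover have "(w has_vector_derivative g t (y t)) (at t)"
        by (rule has_vector_derivative_transform_within_open[of y _ _ "{t1<..<b + h}"])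
          (use 2 y' wy in auto)
      moreover have "(t, y t) \<in> W" using y_tube[of t] 2 W by auto
      ultimately show ?thesis using wy[OF 2] by simp
    qed
    then show "(t, w t) \<in> W" "(w has_vector_derivative g t (w t)) (at t)" by auto
  qed
  moreover have "J \<subseteq> J'" "b \<in> J'" using t1(2) h(1) by (auto simp: J'_def)
  moreover have "\<forall>t\<in>J. w t = u t" using Jb by (simp add: w_def)
  ultimately show ?thesis by blast
qed

text \<open>
  Continuous induction: the set of times up to which the solution exists and stays in the open tube
  is open by continuity and, by the a priori bound \<open>step\<close> and the continuation lemma, closed.
\<close>

lemma maximal_ode_solution_trapped_forward:
  assumes u: "maximal_ode_solution W g J u" and tame: "tame_on_tube W g {c..d} p \<delta>"
    and "c \<le> t1" "t1 \<le> t2" "t2 < d" and t1: "t1 \<in> J" "norm (u t1 - p t1) < \<delta>" and "\<delta>' < \<delta>"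
    and step: "\<forall>t\<in>{t1..t2}. {t1..t} \<subseteq> J \<longrightarrow> (\<forall>s\<in>{t1..t}. norm (u s - p s) < \<delta>) \<longrightarrow>
      norm (u t - p t) \<le> \<delta>'"
  shows "{t1..t2} \<subseteq> J \<and> (\<forall>t\<in>{t1..t2}. norm (u t - p t) \<le> \<delta>')"
proof -
  define good where "good t \<longleftrightarrow> {t1..t} \<subseteq> J \<and> (\<forall>s\<in>{t1..t}. norm (u s - p s) < \<delta>)" for t
  have good_le: "norm (u t - p t) \<le> \<delta>'" if "good s" "t1 \<le> t" "t \<le> s" "t \<le> t2" for s t
  proof -
    have "{t1..t} \<subseteq> {t1..s}" using that by auto
    then have "{t1..t} \<subseteq> J" "\<forall>r\<in>{t1..t}. norm (u r - p r) < \<delta>"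
      using \<open>good s\<close> unfolding good_def by blast+
    then show ?thesis using step that by auto
  qed
  have sol: "ode_solution W g J u" using u by (simp add: maximal_ode_solution_def)
  have cont: "continuous_on (J \<inter> {c..d}) (\<lambda>t. norm (u t - p t))"
    using tame ode_solution_continuous_on[OF sol]
    by (intro continuous_intros) (auto simp: tame_on_tube_def intro: continuous_on_subset)
  have "good t2"
  proof (rule ccontr)
    assume not: "\<not> good t2"
    define S where "S = {t \<in> {t1..t2}. good t}"
    have S: "t1 \<in> S" "bdd_above S" using t1 \<open>t1 \<le> t2\<close> by (auto simp: S_def good_def)
    define b where "b = Sup S"
    have b: "t1 \<le> b" "b \<le> t2"
      unfolding b_def using S by (auto intro!: cSup_upper cSup_least simp: S_def)
    have below: "good t" if "t < b" for t
    proof -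
      have "S \<noteq> {}" using S(1) by blast
      then have "\<exists>s\<in>S. t < s" using less_cSupD[of S t] that unfolding b_def by blast
      then obtain s where "s \<in> S" "t < s" by blast
      then show ?thesis by (auto simp: S_def good_def)
    qed
    have J_below: "{t1..<b} \<subseteq> J" using below by (force simp: good_def)
    have le_below: "norm (u t - p t) \<le> \<delta>'" if "t \<in> {t1..<b}" for t
      using good_le[of t t] below that b by auto
    show False
    proof (cases "b \<in> J")
      case False
      then have "t1 < b" using t1(1) b(1) by (cases "t1 = b") auto
      then obtain J' u' where "ode_solution W g J' u'" "J \<subseteq> J'" "\<forall>t\<in>J. u' t = u t" "b \<in> J'"
        using ode_solution_extends_in_tube[OF sol J_below _ False tame _ _ le_below \<open>\<delta>' < \<delta>\<close>] assms(3,5) b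
        by auto
      then show False using u False unfolding maximal_ode_solution_def by blast
    next
      case True
      have b_cd: "b \<in> J \<inter> {c..d}" using True b assms by auto
      have "norm (u b - p b) < \<delta>"
      proof (cases "t1 = b")
        case False
        then have clo: "closure {t1..<b} = {t1..b}" using b(1) by simp
        have "norm (u b - p b) \<le> \<delta>'"
        proof (rule continuous_le_on_closure[of "{t1..<b}" "\<lambda>t. norm (u t - p t)"])
          have eq: "{t1..b} = insert b {t1..<b}" using b(1) by auto
          have "{t1..<b} \<subseteq> {c..d}" using b(2) assms(3,5) by auto
          then have "{t1..b} \<subseteq> J \<inter> {c..d}"
            unfolding eq using b_cd J_below by blast
          then show "continuous_on (closure {t1..<b}) (\<lambda>t. norm (u t - p t))"
            unfolding clo by (rule continuous_on_subset[OF cont])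
        qed (use clo b(1) le_below in auto)
        with \<open>\<delta>' < \<delta>\<close> show ?thesis by simp
      qed (use t1 in simp)
      moreover have "continuous (at b within J \<inter> {c..d}) (\<lambda>t. norm (u t - p t))"
        using cont b_cd by (simp add: continuous_on_eq_continuous_within)
      ultimately have "\<forall>\<^sub>F t in at b within J \<inter> {c..d}. norm (u t - p t) < \<delta>"
        unfolding continuous_within by (intro order_tendstoD(2))
      then obtain r where r: "r > 0"
        "\<And>t. t \<in> J \<inter> {c..d} \<Longrightarrow> t \<noteq> b \<Longrightarrow> dist t b < r \<Longrightarrow> norm (u t - p t) < \<delta>"
        unfolding eventually_at by blast
      obtain q where q: "q > 0" "ball b q \<subseteq> J"
        using True sol unfolding ode_solution_def by (meson open_contains_ball)
      define t where "t = min t2 (b + min r q / 2)"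
      have t: "b \<le> t" "t \<le> t2" "t < b + r" "t < b + q" "t = t2 \<or> b < t"
        using b q(1) r(1) by (auto simp: t_def)
      have JJ: "s \<in> J" if "s \<in> {b..t}" for s
        using that q(2) t by (auto simp: dist_real_def)
      have "good t"
        unfolding good_def
      proof (intro conjI subsetI ballI)
        fix s assume s: "s \<in> {t1..t}"
        show "s \<in> J" using s JJ[of s] J_below by (cases "s < b") auto
        show "norm (u s - p s) < \<delta>"
        proof (cases s b rule: linorder_cases)
          case less
          then show ?thesis using le_below[of s] s \<open>\<delta>' < \<delta>\<close> by simp
        next
          case equal
          then show ?thesis using \<open>norm (u b - p b) < \<delta>\<close> by simp
        next
          case greater
          then show ?thesis
            using r(2)[of s] JJ[of s] s t(2,3) assms(3,5) b by (simp add: dist_real_def)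
        qed
      qed
      then have "t \<noteq> t2" "t \<in> S" using not t b by (auto simp: S_def)
      then show False using cSup_upper[OF _ S(2), of t] t by (simp add: b_def)
    qed
  qed
  then show ?thesis
    using good_le[OF \<open>good t2\<close>] by (simp add: good_def)
qed

lemma ode_solution_reflect:
  assumes "ode_solution W g J u"
  shows "ode_solution {(t, x). (- t, x) \<in> W} (\<lambda>t x. - g (- t) x) (uminus ` J) (\<lambda>t. u (- t))"
  unfolding ode_solution_def
proof (intro conjI ballI)
  show "uminus ` J \<noteq> {}" "open (uminus ` J)"
    using assms by (auto simp: ode_solution_def open_negations)
  have "connected J" using assms by (simp add: ode_solution_def is_interval_connected_1)
  then have "connected (uminus ` J)" by (intro connected_continuous_image continuous_intros)
  then show "is_interval (uminus ` J)" by (simp add: is_interval_connected_1)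
  fix t assume "t \<in> uminus ` J"
  then have t: "- t \<in> J" by auto
  then show "(t, u (- t)) \<in> {(t, x). (- t, x) \<in> W}" using assms by (simp add: ode_solution_def)
  have "(uminus has_vector_derivative - 1) (at t)"
    by (auto intro!: derivative_eq_intros)
  moreover have "(u has_vector_derivative g (- t) (u (- t))) (at (- t))"
    using assms t by (simp add: ode_solution_def)
  ultimately show "((\<lambda>t. u (- t)) has_vector_derivative - g (- t) (u (- t))) (at t)"
    using vector_diff_chain_at[of uminus "- 1" t u] by (simp add: o_def)
qed

text \<open>
  Time reversal gives the continuation to the left from the continuation to the right.
\<close>

lemma maximal_ode_solution_reflect:
  assumes "maximal_ode_solution W g J u"
  shows "maximal_ode_solution {(t, x). (- t, x) \<in> W} (\<lambda>t x. - g (- t) x) (uminus ` J) (\<lambda>t. u (- t))"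
  unfolding maximal_ode_solution_def
proof (intro conjI allI impI)
  show "ode_solution {(t, x). (- t, x) \<in> W} (\<lambda>t x. - g (- t) x) (uminus ` J) (\<lambda>t. u (- t))"
    using assms by (intro ode_solution_reflect) (simp add: maximal_ode_solution_def)
  fix J' u' assume *: "ode_solution {(t, x). (- t, x) \<in> W} (\<lambda>t x. - g (- t) x) J' u' \<and>
    uminus ` J \<subseteq> J' \<and> (\<forall>t\<in>uminus ` J. u' t = u (- t))"
  then have "ode_solution W g (uminus ` J') (\<lambda>t. u' (- t))"
    using ode_solution_reflect[of "{(t, x). (- t, x) \<in> W}" "\<lambda>t x. - g (- t) x" J' u'] by simp
  moreover have "J \<subseteq> uminus ` J'"
  proof
    fix t assume "t \<in> J"
    then have "- t \<in> J'" using * by blast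
    then show "t \<in> uminus ` J'" by (intro image_eqI[of _ _ "- t"]) auto
  qed
  moreover have "\<forall>t\<in>J. u' (- t) = u t" using * by auto
  ultimately have "J = uminus ` J'" using assms unfolding maximal_ode_solution_def by blast
  then show "J' = uminus ` J" by (simp add: image_image)
qed

lemma tame_on_tube_reflect:
  assumes "tame_on_tube W g {c..d} p \<delta>"
  shows "tame_on_tube {(t, x). (- t, x) \<in> W} (\<lambda>t x. - g (- t) x) {- d..- c} (\<lambda>t. p (- t)) \<delta>"
proof -
  have tube: "(t, x) \<in> tube {- d..- c} (\<lambda>t. p (- t)) \<delta> \<longleftrightarrow> (- t, x) \<in> tube {c..d} p \<delta>" for t x
    by (auto simp: tube_def)
  have cg: "continuous_on (tube {c..d} p \<delta>) (\<lambda>(t, x). g t x)"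
    using assms by (simp add: tame_on_tube_def)
  have "continuous_on (tube {- d..- c} (\<lambda>t. p (- t)) \<delta>) (\<lambda>z. (\<lambda>(t, x). g t x) (- fst z, snd z))"
    by (rule continuous_on_compose2[OF cg]) (auto intro!: continuous_intros simp: tube)
  then have "continuous_on (tube {- d..- c} (\<lambda>t. p (- t)) \<delta>) (\<lambda>(t, x). - g (- t) x)"
    unfolding case_prod_unfold fst_conv snd_conv by (rule continuous_on_minus)
  moreover have "continuous_on {- d..- c} (\<lambda>t. p (- t))"
    by (rule continuous_on_compose2[of "{c..d}" p])
      (use assms in \<open>auto simp: tame_on_tube_def intro!: continuous_intros\<close>)
  moreover have "tube {- d..- c} (\<lambda>t. p (- t)) \<delta> \<subseteq> {(t, x). (- t, x) \<in> W}"
  proof -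
    have "tube {c..d} p \<delta> \<subseteq> W" using assms by (simp add: tame_on_tube_def)
    then show ?thesis by (auto simp: tube)
  qed
  moreover obtain L where "\<And>t x y. (t, x) \<in> tube {c..d} p \<delta> \<Longrightarrow> (t, y) \<in> tube {c..d} p \<delta> \<Longrightarrow>
      norm (g t x - g t y) \<le> L * norm (x - y)"
    using assms unfolding tame_on_tube_def by blast
  then have "norm (- g (- t) x - - g (- t) y) \<le> L * norm (x - y)"
    if "(t, x) \<in> tube {- d..- c} (\<lambda>t. p (- t)) \<delta>" "(t, y) \<in> tube {- d..- c} (\<lambda>t. p (- t)) \<delta>" for t x y
    using that unfolding tube by (simp add: norm_minus_commute)
  ultimately show ?thesis
    unfolding tame_on_tube_def by blast
qed

lemma maximal_ode_solution_trapped: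
  assumes u: "maximal_ode_solution W g J u" and tame: "tame_on_tube W g {c..d} p \<delta>"
    and t12: "t1 \<in> {c<..<d}" "t2 \<in> {c<..<d}"
    and t1: "t1 \<in> J" "norm (u t1 - p t1) < \<delta>" and "\<delta>' < \<delta>"
    and step: "\<And>t. t \<in> closed_segment t1 t2 \<Longrightarrow> closed_segment t1 t \<subseteq> J \<Longrightarrow>
      (\<And>s. s \<in> closed_segment t1 t \<Longrightarrow> norm (u s - p s) < \<delta>) \<Longrightarrow> norm (u t - p t) \<le> \<delta>'"
  shows "closed_segment t1 t2 \<subseteq> J" "\<And>t. t \<in> closed_segment t1 t2 \<Longrightarrow> norm (u t - p t) \<le> \<delta>'"
proof -
  have "closed_segment t1 t2 \<subseteq> J \<and> (\<forall>t\<in>closed_segment t1 t2. norm (u t - p t) \<le> \<delta>')"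
  proof (cases "t1 \<le> t2")
    case True
    then have "\<forall>t\<in>{t1..t2}. {t1..t} \<subseteq> J \<longrightarrow> (\<forall>s\<in>{t1..t}. norm (u s - p s) < \<delta>) \<longrightarrow>
        norm (u t - p t) \<le> \<delta>'"
      using step by (auto simp: closed_segment_eq_real_ivl)
    from maximal_ode_solution_trapped_forward[OF u tame _ True _ t1 \<open>\<delta>' < \<delta>\<close> this] t12 True
    show ?thesis by (simp add: closed_segment_eq_real_ivl)
  next
    case False
    have step': "norm (u (- t) - p (- t)) \<le> \<delta>'" if t: "t \<in> {- t1..- t2}" "{- t1..t} \<subseteq> uminus ` J"
      "\<And>s. s \<in> {- t1..t} \<Longrightarrow> norm (u (- s) - p (- s)) < \<delta>" for t
    proof (rule step)
      have seg: "closed_segment t1 (- t) = {- t..t1}" using t(1) by (auto simp: closed_segment_eq_real_ivl)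
      show "- t \<in> closed_segment t1 t2" using t(1) False by (auto simp: closed_segment_eq_real_ivl)
      show "norm (u s - p s) < \<delta>" if "s \<in> closed_segment t1 (- t)" for s
        using t(3)[of "- s"] that seg by auto
      show "closed_segment t1 (- t) \<subseteq> J"
      proof
        fix s assume "s \<in> closed_segment t1 (- t)"
        then have "- s \<in> {- t1..t}" unfolding seg by auto
        then have "- s \<in> uminus ` J" using t(2) by blast
        then show "s \<in> J" by auto
      qed
    qed
    have pre: "- d \<le> - t1" "- t1 \<le> - t2" "- t2 < - c" "- t1 \<in> uminus ` J"
      "norm (u (- (- t1)) - p (- (- t1))) < \<delta>"
      using t12 t1 False by auto
    have "\<forall>t\<in>{- t1..- t2}. {- t1..t} \<subseteq> uminus ` J \<longrightarrow>
        (\<forall>s\<in>{- t1..t}. norm (u (- s) - p (- s)) < \<delta>) \<longrightarrow> norm (u (- t) - p (- t)) \<le> \<delta>'"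
      using step' by blast
    note trapped = maximal_ode_solution_trapped_forward[OF maximal_ode_solution_reflect[OF u]
        tame_on_tube_reflect[OF tame] pre \<open>\<delta>' < \<delta>\<close> this]
    have "t \<in> J \<and> norm (u t - p t) \<le> \<delta>'" if "t \<in> closed_segment t1 t2" for t
    proof -
      have t: "- t \<in> {- t1..- t2}" using that False by (auto simp: closed_segment_eq_real_ivl)
      then have "- t \<in> uminus ` J" "norm (u (- (- t)) - p (- (- t))) \<le> \<delta>'"
        using trapped by blast+
      then show ?thesis by auto
    qed
    then show ?thesis by blast
  qed
  then show "closed_segment t1 t2 \<subseteq> J" "\<And>t. t \<in> closed_segment t1 t2 \<Longrightarrow> norm (u t - p t) \<le> \<delta>'"
    by auto
qed

section \<open>Growth of solutions of planar equations with rotating linear part\<close>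

lemma gronwall_upper:
  fixes S p :: "real \<Rightarrow> real"
  assumes "s \<le> t" "continuous_on {s..t} S" "continuous_on {s..t} p"
    and "\<And>r. r \<in> {s<..<t} \<Longrightarrow> (S has_real_derivative S' r) (at r)"
    and "\<And>r. r \<in> {s<..<t} \<Longrightarrow> (p has_real_derivative p' r) (at r)"
    and "\<And>r. r \<in> {s<..<t} \<Longrightarrow> S' r \<le> p' r * S r"
  shows "S t \<le> S s * exp (p t - p s)"
proof -
  have "S t * exp (- p t) \<le> S s * exp (- p s)"
  proof (rule DERIV_nonpos_imp_decreasing_open[OF assms(1), of "\<lambda>r. S r * exp (- p r)"])
    show "continuous_on {s..t} (\<lambda>r. S r * exp (- p r))"
      by (intro continuous_intros assms)
    fix r assume "s < r" "r < t"
    then have r: "r \<in> {s<..<t}" by simp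
    have "((\<lambda>r. S r * exp (- p r)) has_real_derivative (S' r - p' r * S r) * exp (- p r)) (at r)"
      by (auto intro!: derivative_eq_intros assms(4)[OF r] assms(5)[OF r] simp: algebra_simps)
    moreover have "(S' r - p' r * S r) * exp (- p r) \<le> 0"
      using assms(6)[OF r] by (simp add: mult_nonpos_nonneg)
    ultimately show "\<exists>y. ((\<lambda>r. S r * exp (- p r)) has_real_derivative y) (at r) \<and> y \<le> 0"
      by blast
  qed
  then have "S t * exp (- p t) * exp (p t) \<le> S s * exp (- p s) * exp (p t)"
    by (rule mult_right_mono) simp
  then show ?thesis by (simp add: mult.assoc flip: exp_add)
qed

lemma gronwall_lower:
  fixes S p :: "real \<Rightarrow> real"
  assumes "s \<le> t" "continuous_on {s..t} S" "continuous_on {s..t} p"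
    and "\<And>r. r \<in> {s<..<t} \<Longrightarrow> (S has_real_derivative S' r) (at r)"
    and "\<And>r. r \<in> {s<..<t} \<Longrightarrow> (p has_real_derivative p' r) (at r)"
    and "\<And>r. r \<in> {s<..<t} \<Longrightarrow> p' r * S r \<le> S' r"
  shows "S s * exp (p t - p s) \<le> S t"
  using gronwall_upper[OF assms(1) continuous_on_minus[OF assms(2)] assms(3) DERIV_minus[OF assms(4)] assms(5)]
    assms(6) by simp

text \<open>
  Towards the future the bound comes from the upper estimate of \<open>S'\<close>, towards the past from the
  lower one. In both cases the error \<open>\<eta>\<close> enters with the elapsed time.
\<close>

lemma gronwall_two_sided:
  fixes S E :: "real \<Rightarrow> real"
  assumes "0 < e"
    and S: "\<And>r. r \<in> {s1..s2} \<Longrightarrow> (S has_real_derivative S' r) (at r)"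
    and E: "continuous_on {s1..s2} E" "\<And>r. r \<in> {s1<..<s2} \<Longrightarrow> (E has_real_derivative \<alpha> r) (at r)"
    and ineq: "\<And>r. r \<in> {s1..s2} \<Longrightarrow> \<bar>e * S' r - k * \<alpha> r * S r\<bar> \<le> k * \<eta> * S r"
    and st: "s \<in> {s1..s2}" "t \<in> {s1..s2}"
  shows "S t \<le> S s * exp (k * (E t - E s + \<eta> * \<bar>t - s\<bar>) / e)"
proof -
  have contS: "continuous_on {s1..s2} S"
    using S by (meson DERIV_isCont continuous_at_imp_continuous_on)
  define P where "P \<sigma> r = k * (E r + \<sigma> * \<eta> * r) / e" for \<sigma> r
  have contP: "continuous_on I (P \<sigma>)" if "I \<subseteq> {s1..s2}" for I \<sigma>
    unfolding P_def by (intro continuous_intros continuous_on_subset[OF E(1) that]) (use assms(1) in auto)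
  have P': "(P \<sigma> has_real_derivative k * (\<alpha> r + \<sigma> * \<eta>) / e) (at r)" if "r \<in> {s1<..<s2}" for r \<sigma>
    unfolding P_def using E(2)[OF that] assms(1) by (auto intro!: derivative_eq_intros)
  show ?thesis
  proof (cases "s \<le> t")
    case True
    have sub: "{s..t} \<subseteq> {s1..s2}" "{s<..<t} \<subseteq> {s1<..<s2}" "{s<..<t} \<subseteq> {s1..s2}" using st by auto
    have "S t \<le> S s * exp (P 1 t - P 1 s)"
    proof (rule gronwall_upper[OF True continuous_on_subset[OF contS sub(1)] contP[OF sub(1)]])
      fix r assume "r \<in> {s<..<t}"
      then have r: "r \<in> {s1..s2}" "r \<in> {s1<..<s2}" using sub by auto
      show "(S has_real_derivative S' r) (at r)" "(P 1 has_real_derivative k * (\<alpha> r + 1 * \<eta>) / e) (at r)"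
        using S P' r by blast+
      have "e * S' r \<le> k * \<alpha> r * S r + k * \<eta> * S r" using ineq[OF r(1)] by linarith
      then show "S' r \<le> k * (\<alpha> r + 1 * \<eta>) / e * S r" using assms(1) by (simp add: field_simps)
    qed
    also have "P 1 t - P 1 s = k * (E t - E s + \<eta> * \<bar>t - s\<bar>) / e"
      using True by (simp add: P_def algebra_simps diff_divide_distrib add_divide_distrib)
    finally show ?thesis .
  next
    case False
    then have "t \<le> s" by simp
    have sub: "{t..s} \<subseteq> {s1..s2}" "{t<..<s} \<subseteq> {s1<..<s2}" "{t<..<s} \<subseteq> {s1..s2}" using st by auto
    have "S t * exp (P (- 1) s - P (- 1) t) \<le> S s"
    proof (rule gronwall_lower[OF \<open>t \<le> s\<close> continuous_on_subset[OF contS sub(1)] contP[OF sub(1)]])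
      fix r assume "r \<in> {t<..<s}"
      then have r: "r \<in> {s1..s2}" "r \<in> {s1<..<s2}" using sub by auto
      show "(S has_real_derivative S' r) (at r)" "(P (- 1) has_real_derivative k * (\<alpha> r + (- 1) * \<eta>) / e) (at r)"
        using S P' r by blast+
      have "k * \<alpha> r * S r - k * \<eta> * S r \<le> e * S' r" using ineq[OF r(1)] by linarith
      then show "k * (\<alpha> r + (- 1) * \<eta>) / e * S r \<le> S' r" using assms(1) by (simp add: field_simps)
    qed
    from mult_right_mono[OF this, of "exp (P (- 1) t - P (- 1) s)"]
    have "S t \<le> S s * exp (P (- 1) t - P (- 1) s)"
      by (simp add: mult.assoc flip: exp_add)
    also have "P (- 1) t - P (- 1) s = k * (E t - E s + \<eta> * \<bar>t - s\<bar>) / e"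
      using False by (simp add: P_def algebra_simps diff_divide_distrib add_divide_distrib)
    finally show ?thesis .
  qed
qed

lemma smooth_approximation:
  fixes h :: "real \<Rightarrow> real"
  assumes "continuous_on {c..d} h" "0 < \<theta>"
  obtains p p' K where "\<And>t. (p has_real_derivative p' t) (at t)"
    "\<And>t. t \<in> {c..d} \<Longrightarrow> \<bar>h t - p t\<bar> < \<theta>" "\<And>t. t \<in> {c..d} \<Longrightarrow> \<bar>p' t\<bar> \<le> K"
proof -
  obtain p where p: "real_polynomial_function p" "\<And>t. t \<in> {c..d} \<Longrightarrow> \<bar>h t - p t\<bar> < \<theta>"
    using Stone_Weierstrass_real_polynomial_function[OF compact_Icc assms] by blast
  obtain p' where p': "polynomial_function p'" "\<And>t. (p has_vector_derivative p' t) (at t)"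
    using has_vector_derivative_polynomial_function[of p] p(1) by (auto simp: real_polynomial_function_eq)
  have "continuous_on {c..d} p'" using p'(1) by (rule continuous_on_polymonial_function)
  then have "bounded (p' ` {c..d})" by (intro compact_imp_bounded compact_continuous_image) auto
  then obtain K where "\<And>t. t \<in> {c..d} \<Longrightarrow> \<bar>p' t\<bar> \<le> K" unfolding bounded_iff by force
  with p(2) p'(2) show thesis
    by (intro that[of p p' K]) (auto simp: has_real_derivative_iff_has_vector_derivative)
qed

text \<open>
  With \<open>B\<close> the traceless matrix with rows \<open>(b, q)\<close> and \<open>(r, - b)\<close> this is the determinant of the
  vectors \<open>y\<close> and \<open>B y\<close>. As \<open>B\<^sup>2\<close> is the scalar \<open>b\<^sup>2 + q r\<close>, every solution of \<open>y' = (\<alpha> + B) y\<close> with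
  constant \<open>B\<close> makes the form grow exactly at the rate \<open>2 \<alpha>\<close>.
\<close>

definition rotation_form :: "real \<Rightarrow> real \<Rightarrow> real \<Rightarrow> real^2 \<Rightarrow> real" where
  "rotation_form b q r y = r * (y $ 1)\<^sup>2 - 2 * b * y $ 1 * y $ 2 - q * (y $ 2)\<^sup>2"

lemma norm_squared_2: "(norm (y :: real^2))\<^sup>2 = (y $ 1)\<^sup>2 + (y $ 2)\<^sup>2"
  by (simp add: norm_vec_def L2_set_def sum_2)

text \<open>
  Multiplied by \<open>r\<close> or by \<open>- q\<close>, the form is a square plus \<open>- (b\<^sup>2 + q r)\<close> times the square of one
  component. This covers both signs of the form.
\<close>

lemma rotation_form_definite:
  assumes "\<bar>q\<bar> \<le> M" "\<bar>r\<bar> \<le> M" "b\<^sup>2 + q * r \<le> - w"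
  shows "w * (norm y)\<^sup>2 \<le> 2 * M * \<bar>rotation_form b q r y\<bar>"
proof -
  let ?Q = "rotation_form b q r y"
  have "w * (y $ 2)\<^sup>2 \<le> - (b\<^sup>2 + q * r) * (y $ 2)\<^sup>2"
    using assms(3) by (intro mult_right_mono) auto
  also have "\<dots> \<le> r * ?Q"
    using zero_le_power2[of "r * y $ 1 - b * y $ 2"]
    by (simp add: rotation_form_def power2_eq_square algebra_simps)
  also have "\<dots> \<le> M * \<bar>?Q\<bar>"
    using mult_right_mono[OF assms(2), of "\<bar>?Q\<bar>"] abs_ge_self[of "r * ?Q"] by (simp add: abs_mult)
  finally have 2: "w * (y $ 2)\<^sup>2 \<le> M * \<bar>?Q\<bar>" .
  have "w * (y $ 1)\<^sup>2 \<le> - (b\<^sup>2 + q * r) * (y $ 1)\<^sup>2"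
    using assms(3) by (intro mult_right_mono) auto
  also have "\<dots> \<le> - q * ?Q"
    using zero_le_power2[of "b * y $ 1 + q * y $ 2"]
    by (simp add: rotation_form_def power2_eq_square algebra_simps)
  also have "\<dots> \<le> M * \<bar>?Q\<bar>"
    using mult_right_mono[OF assms(1), of "\<bar>?Q\<bar>"] abs_ge_self[of "- q * ?Q"] by (simp add: abs_mult)
  finally show ?thesis using 2 by (simp add: norm_squared_2 algebra_simps)
qed

lemma rotation_form_bound:
  assumes "\<bar>b\<bar> \<le> M" "\<bar>q\<bar> \<le> M" "\<bar>r\<bar> \<le> M"
  shows "\<bar>rotation_form b q r y\<bar> \<le> 2 * M * (norm y)\<^sup>2"
proof -
  have "\<bar>rotation_form b q r y\<bar> \<le> \<bar>r\<bar> * (y $ 1)\<^sup>2 + \<bar>b\<bar> * (2 * \<bar>y $ 1\<bar> * \<bar>y $ 2\<bar>) + \<bar>q\<bar> * (y $ 2)\<^sup>2"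
    unfolding rotation_form_def
    using abs_triangle_ineq4[of "r * (y $ 1)\<^sup>2 - 2 * b * y $ 1 * y $ 2" "q * (y $ 2)\<^sup>2"]
      abs_triangle_ineq4[of "r * (y $ 1)\<^sup>2" "2 * b * y $ 1 * y $ 2"]
    by (simp add: abs_mult mult_ac)
  also have "\<dots> \<le> M * (y $ 1)\<^sup>2 + M * ((y $ 1)\<^sup>2 + (y $ 2)\<^sup>2) + M * (y $ 2)\<^sup>2"
  proof (intro add_mono mult_mono assms)
    show "2 * \<bar>y $ 1\<bar> * \<bar>y $ 2\<bar> \<le> (y $ 1)\<^sup>2 + (y $ 2)\<^sup>2"
      using sum_squares_bound[of "\<bar>y $ 1\<bar>" "\<bar>y $ 2\<bar>"] by simp
  qed (use assms in auto)
  finally show ?thesis by (simp add: norm_squared_2 algebra_simps)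
qed

text \<open>
  The first summand on the right comes from the variation of the coefficients, the other two from
  the deviation of \<open>y\<close> from a solution of \<open>e y' = (\<alpha> + B) y\<close>; what remains is the rate \<open>2 \<alpha>\<close>.
\<close>

lemma rotation_form_derivative:
  fixes b q r :: "real \<Rightarrow> real" and y :: "real \<Rightarrow> real^2" and b' q' r' e \<alpha> :: real
  assumes b: "(b has_real_derivative b') (at t)" and q: "(q has_real_derivative q') (at t)"
    and r: "(r has_real_derivative r') (at t)" and y: "(y has_vector_derivative y') (at t)"
  obtains Q' where
    "((\<lambda>t. rotation_form (b t) (q t) (r t) (y t)) has_real_derivative Q') (at t)"
    "e * Q' - 2 * \<alpha> * rotation_form (b t) (q t) (r t) (y t) =
       e * rotation_form b' q' r' (y t)
       + 2 * (r t * y t $ 1 - b t * y t $ 2) * (e * y' $ 1 - (\<alpha> + b t) * y t $ 1 - q t * y t $ 2)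
       - 2 * (b t * y t $ 1 + q t * y t $ 2) * (e * y' $ 2 - r t * y t $ 1 - (\<alpha> - b t) * y t $ 2)"
proof -
  have y': "((\<lambda>t. y t $ i) has_real_derivative y' $ i) (at t)" for i
    using bounded_linear.has_vector_derivative[OF bounded_linear_vec_nth y]
    by (simp add: has_real_derivative_iff_has_vector_derivative)
  show thesis
  proof (rule that)
    show "((\<lambda>t. rotation_form (b t) (q t) (r t) (y t)) has_real_derivative
        r' * (y t $ 1)\<^sup>2 + r t * (2 * y t $ 1 * y' $ 1)
        - 2 * (b' * y t $ 1 * y t $ 2 + b t * y' $ 1 * y t $ 2 + b t * y t $ 1 * y' $ 2)
        - (q' * (y t $ 2)\<^sup>2 + q t * (2 * y t $ 2 * y' $ 2))) (at t)"
      unfolding rotation_form_def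
      by (auto intro!: derivative_eq_intros b q r y' simp: algebra_simps)
  qed (simp add: rotation_form_def algebra_simps power2_eq_square)
qed

text \<open>
  The rotation form measures the square of the norm up to constants and grows at the rate \<open>2 \<alpha> / e\<close>,
  where \<open>\<alpha>\<close> is half the trace. As the entries of \<open>A\<close> are only continuous, the form is built from
  polynomials close to them; the approximation error, the perturbation \<open>\<theta>\<close> and the derivatives of the
  polynomials, which carry the factor \<open>e\<close>, are absorbed in \<open>\<eta>\<close>.
\<close>

lemma linear_ode_growth:
  fixes A :: "real \<Rightarrow> real^2^2" and E :: "real \<Rightarrow> real"
  assumes A: "\<And>j k. continuous_on {c..d} (\<lambda>t. A t $ j $ k)"
    and rot: "\<And>t. t \<in> {c..d} \<Longrightarrow> ((A t $ 1 $ 1 - A t $ 2 $ 2) / 2)\<^sup>2 + A t $ 1 $ 2 * A t $ 2 $ 1 < 0"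
    and E: "\<And>t. t \<in> {c..d} \<Longrightarrow>
      (E has_real_derivative (A t $ 1 $ 1 + A t $ 2 $ 2) / 2) (at t within {c..d})"
    and "0 < \<eta>"
  obtains C \<theta> e0 where "0 < C" "0 < \<theta>" "0 < e0"
    "\<And>e s1 s2 y y' s t. 0 < e \<Longrightarrow> e \<le> e0 \<Longrightarrow> {s1..s2} \<subseteq> {c..d} \<Longrightarrow>
      (\<And>t. t \<in> {s1..s2} \<Longrightarrow> (y has_vector_derivative y' t) (at t)) \<Longrightarrow>
      (\<And>t. t \<in> {s1..s2} \<Longrightarrow> norm (e *\<^sub>R y' t - A t *v y t) \<le> \<theta> * norm (y t)) \<Longrightarrow>
      s \<in> {s1..s2} \<Longrightarrow> t \<in> {s1..s2} \<Longrightarrow>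
      norm (y t) \<le> C * norm (y s) * exp ((E t - E s + \<eta> * \<bar>t - s\<bar>) / e)"
proof -
  define \<alpha> where "\<alpha> t = (A t $ 1 $ 1 + A t $ 2 $ 2) / 2" for t
  define b where "b t = (A t $ 1 $ 1 - A t $ 2 $ 2) / 2" for t
  define q where "q t = A t $ 1 $ 2" for t
  define r where "r t = A t $ 2 $ 1" for t
  have cont: "continuous_on {c..d} b" "continuous_on {c..d} q" "continuous_on {c..d} r"
    unfolding b_def q_def r_def by (intro continuous_intros A; simp)+
  have rot': "b t ^ 2 + q t * r t < 0" if "t \<in> {c..d}" for t
    using rot[OF that] by (simp add: b_def q_def r_def)
  obtain w where w: "0 < w" "\<And>t. t \<in> {c..d} \<Longrightarrow> b t ^ 2 + q t * r t \<le> - w"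
  proof (cases "{c..d} = {}")
    case True
    then show thesis by (intro that[of 1]) auto
  next
    case False
    have "continuous_on {c..d} (\<lambda>t. b t ^ 2 + q t * r t)" by (intro continuous_intros cont)
    from continuous_attains_sup[OF compact_Icc False this] obtain t0 where
      "t0 \<in> {c..d}" "\<And>t. t \<in> {c..d} \<Longrightarrow> b t ^ 2 + q t * r t \<le> b t0 ^ 2 + q t0 * r t0"
      by blast
    then show thesis
      using rot'[of t0] by (intro that[of "- (b t0 ^ 2 + q t0 * r t0)"]) (simp_all only: minus_minus neg_0_less_iff_less)
  qed
  have bdd: "\<exists>M. \<forall>t\<in>{c..d}. \<bar>h t\<bar> \<le> M" if "continuous_on {c..d} h" for h :: "real \<Rightarrow> real"
    using compact_imp_bounded[OF compact_continuous_image[OF that compact_Icc]]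
    unfolding bounded_iff by force
  obtain Mb Mq Mr where Ms: "\<And>t. t \<in> {c..d} \<Longrightarrow> \<bar>b t\<bar> \<le> Mb"
    "\<And>t. t \<in> {c..d} \<Longrightarrow> \<bar>q t\<bar> \<le> Mq" "\<And>t. t \<in> {c..d} \<Longrightarrow> \<bar>r t\<bar> \<le> Mr"
    using bdd[OF cont(1)] bdd[OF cont(2)] bdd[OF cont(3)] by blast
  define M where "M = 1 + \<bar>Mb\<bar> + \<bar>Mq\<bar> + \<bar>Mr\<bar>"
  have "M > 0" by (simp add: M_def)
  have M: "\<bar>b t\<bar> \<le> M" "\<bar>q t\<bar> \<le> M" "\<bar>r t\<bar> \<le> M" if "t \<in> {c..d}" for t
    using Ms[OF that] by (auto simp: M_def)
  define \<kappa> where "\<kappa> = w / (2 * M)"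
  have "\<kappa> > 0" using w(1) \<open>M > 0\<close> by (simp add: \<kappa>_def)
  \<comment> \<open>\<open>\<kappa> / 4\<close> keeps the approximating form definite; the last bound makes the errors proportional to \<open>\<theta>\<close>
    at most half of what \<open>\<eta>\<close> allows, the other half being left to \<open>e0\<close>.\<close>
  define \<theta> where "\<theta> = min 1 (min (\<kappa> / 4) (\<eta> * \<kappa> / (48 * (M + 1))))"
  have \<theta>: "0 < \<theta>" "\<theta> \<le> 1" "\<theta> \<le> \<kappa> / 4" "24 * (M + 1) * \<theta> \<le> \<eta> * \<kappa> / 2"
  proof -
    show "0 < \<theta>" using \<open>\<kappa> > 0\<close> \<open>0 < \<eta>\<close> \<open>M > 0\<close> by (simp add: \<theta>_def)
    show "\<theta> \<le> 1" "\<theta> \<le> \<kappa> / 4" unfolding \<theta>_def by linarith+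
    have "\<theta> \<le> \<eta> * \<kappa> / (48 * (M + 1))" by (simp add: \<theta>_def)
    then show "24 * (M + 1) * \<theta> \<le> \<eta> * \<kappa> / 2" using \<open>M > 0\<close> by (simp add: field_simps)
  qed
  obtain b1 b1' Kb where b1: "\<And>t. (b1 has_real_derivative b1' t) (at t)"
    "\<And>t. t \<in> {c..d} \<Longrightarrow> \<bar>b t - b1 t\<bar> < \<theta>" "\<And>t. t \<in> {c..d} \<Longrightarrow> \<bar>b1' t\<bar> \<le> Kb"
    by (rule smooth_approximation[OF cont(1) \<theta>(1)]) blast
  obtain q1 q1' Kq where q1: "\<And>t. (q1 has_real_derivative q1' t) (at t)"
    "\<And>t. t \<in> {c..d} \<Longrightarrow> \<bar>q t - q1 t\<bar> < \<theta>" "\<And>t. t \<in> {c..d} \<Longrightarrow> \<bar>q1' t\<bar> \<le> Kq"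
    by (rule smooth_approximation[OF cont(2) \<theta>(1)]) blast
  obtain r1 r1' Kr where r1: "\<And>t. (r1 has_real_derivative r1' t) (at t)"
    "\<And>t. t \<in> {c..d} \<Longrightarrow> \<bar>r t - r1 t\<bar> < \<theta>" "\<And>t. t \<in> {c..d} \<Longrightarrow> \<bar>r1' t\<bar> \<le> Kr"
    by (rule smooth_approximation[OF cont(3) \<theta>(1)]) blast
  define K where "K = 1 + \<bar>Kb\<bar> + \<bar>Kq\<bar> + \<bar>Kr\<bar>"
  have "K > 0" by (simp add: K_def)
  define e0 where "e0 = \<eta> * \<kappa> / (4 * K)"
  have "e0 > 0" using \<open>0 < \<eta>\<close> \<open>\<kappa> > 0\<close> \<open>K > 0\<close> by (simp add: e0_def)
  define Q where "Q t = rotation_form (b1 t) (q1 t) (r1 t)" for t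
  have M1: "\<bar>b1 t\<bar> \<le> M + 1" "\<bar>q1 t\<bar> \<le> M + 1" "\<bar>r1 t\<bar> \<le> M + 1" if "t \<in> {c..d}" for t
    using M[OF that] b1(2)[OF that] q1(2)[OF that] r1(2)[OF that] \<theta>(2) by linarith+
  have Q_upper: "\<bar>Q t y\<bar> \<le> 2 * (M + 1) * (norm y)\<^sup>2" if "t \<in> {c..d}" for t y
    unfolding Q_def by (rule rotation_form_bound[OF M1[OF that]])
  have Q_lower: "\<kappa> / 2 * (norm y)\<^sup>2 \<le> \<bar>Q t y\<bar>" if t: "t \<in> {c..d}" for t y
  proof -
    have "\<kappa> * (norm y)\<^sup>2 \<le> \<bar>rotation_form (b t) (q t) (r t) y\<bar>"
      using rotation_form_definite[OF M(2,3)[OF t] w(2)[OF t], of y] \<open>M > 0\<close>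
      by (simp add: \<kappa>_def field_simps)
    moreover have "rotation_form (b t) (q t) (r t) y = Q t y + rotation_form (b t - b1 t) (q t - q1 t) (r t - r1 t) y"
      by (simp add: Q_def rotation_form_def algebra_simps)
    moreover have "\<bar>rotation_form (b t - b1 t) (q t - q1 t) (r t - r1 t) y\<bar> \<le> 2 * \<theta> * (norm y)\<^sup>2"
      using b1(2)[OF t] q1(2)[OF t] r1(2)[OF t] by (intro rotation_form_bound) auto
    moreover have "2 * \<theta> * (norm y)\<^sup>2 \<le> \<kappa> / 2 * (norm y)\<^sup>2"
      using \<theta>(3) by (intro mult_right_mono) auto
    ultimately show ?thesis by (simp add: field_simps)
  qed
  define C where "C = 4 * (M + 1) / \<kappa> + 1"
  have C: "0 < C" "(4 * (M + 1) / \<kappa>)\<^sup>2 \<le> C ^ 4"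
  proof -
    have "0 < 4 * (M + 1) / \<kappa>" using \<open>\<kappa> > 0\<close> \<open>M > 0\<close> by simp
    then have "1 \<le> C" "(4 * (M + 1) / \<kappa>)\<^sup>2 \<le> C\<^sup>2" by (auto simp: C_def intro!: power_mono)
    moreover have "C\<^sup>2 \<le> C ^ 4" using \<open>1 \<le> C\<close> by (intro power_increasing) auto
    ultimately show "0 < C" "(4 * (M + 1) / \<kappa>)\<^sup>2 \<le> C ^ 4" by auto
  qed
  show thesis
  proof (rule that[OF C(1) \<theta>(1) \<open>e0 > 0\<close>])
    fix e s1 s2 s t :: real and y y' :: "real \<Rightarrow> real^2"
    assume e: "0 < e" "e \<le> e0" and sub: "{s1..s2} \<subseteq> {c..d}"
      and y': "\<And>t. t \<in> {s1..s2} \<Longrightarrow> (y has_vector_derivative y' t) (at t)"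
      and close: "\<And>t. t \<in> {s1..s2} \<Longrightarrow> norm (e *\<^sub>R y' t - A t *v y t) \<le> \<theta> * norm (y t)"
      and s: "s \<in> {s1..s2}" and t: "t \<in> {s1..s2}"
    have "\<exists>Q'. ((\<lambda>t. Q t (y t)) has_real_derivative Q') (at t) \<and>
        \<bar>e * Q' - 2 * \<alpha> t * Q t (y t)\<bar> \<le> 2 * \<eta> * \<bar>Q t (y t)\<bar>" if t12: "t \<in> {s1..s2}" for t
    proof -
      have t: "t \<in> {c..d}" using t12 sub by blast
      let ?n = "norm (y t)"
      let ?E1 = "e * y' t $ 1 - (\<alpha> t + b1 t) * y t $ 1 - q1 t * y t $ 2"
      let ?E2 = "e * y' t $ 2 - r1 t * y t $ 1 - (\<alpha> t - b1 t) * y t $ 2"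
      obtain Q' where Q': "((\<lambda>t. Q t (y t)) has_real_derivative Q') (at t)"
        "e * Q' - 2 * \<alpha> t * Q t (y t) = e * rotation_form (b1' t) (q1' t) (r1' t) (y t)
           + 2 * (r1 t * y t $ 1 - b1 t * y t $ 2) * ?E1 - 2 * (b1 t * y t $ 1 + q1 t * y t $ 2) * ?E2"
        unfolding Q_def
        by (rule rotation_form_derivative[OF b1(1) q1(1) r1(1) y'[OF t12], of e "\<alpha> t"]) blast
      have comp: "\<bar>y t $ i\<bar> \<le> ?n" for i by (rule component_le_norm_cart)
      have lin: "\<bar>u * y t $ 1 + v * y t $ 2\<bar> \<le> 2 * m * ?n" if "\<bar>u\<bar> \<le> m" "\<bar>v\<bar> \<le> m" for u v m
      proof -
        have "\<bar>u * y t $ 1 + v * y t $ 2\<bar> \<le> \<bar>u\<bar> * \<bar>y t $ 1\<bar> + \<bar>v\<bar> * \<bar>y t $ 2\<bar>"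
          using abs_triangle_ineq[of "u * y t $ 1" "v * y t $ 2"] by (simp add: abs_mult)
        also have "\<dots> \<le> m * ?n + m * ?n"
          using that comp by (intro add_mono mult_mono) auto
        finally show ?thesis by simp
      qed
      have d: "\<bar>(e *\<^sub>R y' t - A t *v y t) $ i\<bar> \<le> \<theta> * ?n" for i
        using component_le_norm_cart close[OF t12] by (rule order_trans)
      have "?E1 = (e *\<^sub>R y' t - A t *v y t) $ 1 + ((b t - b1 t) * y t $ 1 + (q t - q1 t) * y t $ 2)"
        by (simp add: matrix_vector_mult_def sum_2 \<alpha>_def b_def q_def field_simps)
      then have E1: "\<bar>?E1\<bar> \<le> 3 * \<theta> * ?n"
        using d[of 1] lin[of "b t - b1 t" \<theta> "q t - q1 t"] b1(2)[OF t] q1(2)[OF t] by linarith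
      have "?E2 = (e *\<^sub>R y' t - A t *v y t) $ 2 + ((r t - r1 t) * y t $ 1 + (b1 t - b t) * y t $ 2)"
        by (simp add: matrix_vector_mult_def sum_2 \<alpha>_def b_def r_def field_simps)
      then have E2: "\<bar>?E2\<bar> \<le> 3 * \<theta> * ?n"
        using d[of 2] lin[of "r t - r1 t" \<theta> "b1 t - b t"] b1(2)[OF t] r1(2)[OF t] by linarith
      have "\<bar>rotation_form (b1' t) (q1' t) (r1' t) (y t)\<bar> \<le> 2 * K * ?n\<^sup>2"
        using b1(3)[OF t] q1(3)[OF t] r1(3)[OF t] by (intro rotation_form_bound) (auto simp: K_def)
      then have "\<bar>e * rotation_form (b1' t) (q1' t) (r1' t) (y t)\<bar> \<le> e0 * (2 * K * ?n\<^sup>2)"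
        unfolding abs_mult using e by (intro mult_mono) auto
      also have "\<dots> = \<eta> * \<kappa> / 2 * ?n\<^sup>2" using \<open>K > 0\<close> by (simp add: e0_def)
      finally have 0: "\<bar>e * rotation_form (b1' t) (q1' t) (r1' t) (y t)\<bar> \<le> \<eta> * \<kappa> / 2 * ?n\<^sup>2" .
      have prod: "\<bar>2 * u * v\<bar> \<le> 12 * (M + 1) * \<theta> * ?n\<^sup>2"
        if "\<bar>u\<bar> \<le> 2 * (M + 1) * ?n" "\<bar>v\<bar> \<le> 3 * \<theta> * ?n" for u v
      proof -
        have "\<bar>2 * u * v\<bar> = 2 * (\<bar>u\<bar> * \<bar>v\<bar>)" by (simp add: abs_mult)
        also have "\<dots> \<le> 2 * ((2 * (M + 1) * ?n) * (3 * \<theta> * ?n))"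
          using that \<open>M > 0\<close> by (intro mult_left_mono mult_mono) auto
        finally show ?thesis by (simp add: power2_eq_square mult_ac)
      qed
      have "\<bar>r1 t * y t $ 1 - b1 t * y t $ 2\<bar> \<le> 2 * (M + 1) * ?n"
        using lin[of "r1 t" "M + 1" "- b1 t"] M1[OF t] by simp
      note 1 = prod[OF this E1]
      have "\<bar>b1 t * y t $ 1 + q1 t * y t $ 2\<bar> \<le> 2 * (M + 1) * ?n"
        by (rule lin) (use M1[OF t] in auto)
      note 2 = prod[OF this E2]
      have "\<bar>e * Q' - 2 * \<alpha> t * Q t (y t)\<bar> \<le> \<eta> * \<kappa> / 2 * ?n\<^sup>2 + 24 * (M + 1) * \<theta> * ?n\<^sup>2"
        unfolding Q'(2) using 0 1 2 by linarith
      also have "\<dots> \<le> \<eta> * \<kappa> / 2 * ?n\<^sup>2 + \<eta> * \<kappa> / 2 * ?n\<^sup>2"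
        using \<theta>(4) by (intro add_mono mult_right_mono) auto
      also have "\<dots> = 2 * \<eta> * (\<kappa> / 2 * ?n\<^sup>2)" by simp
      also have "\<dots> \<le> 2 * \<eta> * \<bar>Q t (y t)\<bar>"
        using Q_lower[OF t] \<open>0 < \<eta>\<close> by (intro mult_left_mono) auto
      finally show ?thesis using Q'(1) by blast
    qed
    then obtain Q' where Q': "\<And>t. t \<in> {s1..s2} \<Longrightarrow> ((\<lambda>t. Q t (y t)) has_real_derivative Q' t) (at t)"
      "\<And>t. t \<in> {s1..s2} \<Longrightarrow> \<bar>e * Q' t - 2 * \<alpha> t * Q t (y t)\<bar> \<le> 2 * \<eta> * \<bar>Q t (y t)\<bar>"
      by metis
    \<comment> \<open>The square does not depend on the sign of the form; it compares with \<open>norm (y t) ^ 4\<close>.\<close>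
    define S where "S t = (Q t (y t))\<^sup>2" for t
    have "S t \<le> S s * exp (4 * (E t - E s + \<eta> * \<bar>t - s\<bar>) / e)"
    proof (rule gronwall_two_sided[OF e(1) _ _ _ _ s t])
      fix r assume r: "r \<in> {s1..s2}"
      show "(S has_real_derivative 2 * Q r (y r) * Q' r) (at r)"
        unfolding S_def using Q'(1)[OF r] by (auto intro!: derivative_eq_intros)
      have "e * (2 * Q r (y r) * Q' r) - 4 * \<alpha> r * S r = 2 * Q r (y r) * (e * Q' r - 2 * \<alpha> r * Q r (y r))"
        by (simp add: S_def power2_eq_square algebra_simps)
      also have "\<bar>\<dots>\<bar> \<le> 2 * \<bar>Q r (y r)\<bar> * (2 * \<eta> * \<bar>Q r (y r)\<bar>)"
        unfolding abs_mult[of "2 * _"] using Q'(2)[OF r] by (intro mult_mono) (auto simp: abs_mult)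
      also have "\<dots> = 4 * \<eta> * S r" by (simp add: S_def power2_eq_square)
      finally show "\<bar>e * (2 * Q r (y r) * Q' r) - 4 * \<alpha> r * S r\<bar> \<le> 4 * \<eta> * S r" .
    next
      have "continuous_on {c..d} E" using E by (rule DERIV_continuous_on)
      then show "continuous_on {s1..s2} E" by (rule continuous_on_subset[OF _ sub])
      fix r assume r: "r \<in> {s1<..<s2}"
      then have "(E has_real_derivative \<alpha> r) (at r within {s1..s2})"
        using E[of r] sub unfolding \<alpha>_def by (intro DERIV_subset[OF _ sub]) force
      then show "(E has_real_derivative \<alpha> r) (at r)" using r at_within_Icc_at[of s1 r s2] by simp
    qed
    define x where "x = exp ((E t - E s + \<eta> * \<bar>t - s\<bar>) / e)"
    have "exp (4 * (E t - E s + \<eta> * \<bar>t - s\<bar>) / e) = x ^ 4"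
      unfolding x_def by (simp flip: exp_of_nat_mult)
    with \<open>S t \<le> _\<close> have St: "S t \<le> S s * x ^ 4" by simp
    have "(\<kappa> / 2)\<^sup>2 * norm (y t) ^ 4 = (\<kappa> / 2 * (norm (y t))\<^sup>2)\<^sup>2"
      by (simp add: power_divide power_mult_distrib flip: power_mult)
    also have "\<dots> \<le> S t"
      unfolding S_def using Q_lower[of t "y t"] t sub \<open>\<kappa> > 0\<close>
      by (subst power2_abs[symmetric, of "Q t (y t)"], intro power_mono) auto
    also have "\<dots> \<le> S s * x ^ 4" by (rule St)
    also have "S s \<le> (2 * (M + 1) * (norm (y s))\<^sup>2)\<^sup>2"
      unfolding S_def using Q_upper[of s "y s"] s sub
      by (subst power2_abs[symmetric, of "Q s (y s)"], intro power_mono) auto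
    also have "(2 * (M + 1) * (norm (y s))\<^sup>2)\<^sup>2 = (2 * (M + 1))\<^sup>2 * norm (y s) ^ 4"
      by (simp add: power_mult_distrib flip: power_mult)
    finally have "(\<kappa> / 2)\<^sup>2 * norm (y t) ^ 4 \<le> (2 * (M + 1))\<^sup>2 * norm (y s) ^ 4 * x ^ 4"
      by (simp add: x_def mult_right_mono)
    moreover have "4 * (M + 1) / \<kappa> = 2 * (M + 1) / (\<kappa> / 2)" by simp
    then have eq: "(4 * (M + 1) / \<kappa>)\<^sup>2 = (2 * (M + 1))\<^sup>2 / (\<kappa> / 2)\<^sup>2"
      by (simp only: power_divide)
    have pos: "0 < (\<kappa> / 2)\<^sup>2" using \<open>\<kappa> > 0\<close> by simp
    ultimately have "norm (y t) ^ 4 \<le> (4 * (M + 1) / \<kappa>)\<^sup>2 * (norm (y s) ^ 4 * x ^ 4)"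
      unfolding eq times_divide_eq_left pos_le_divide_eq[OF pos] by (simp only: mult_ac)
    also have "\<dots> \<le> C ^ 4 * (norm (y s) ^ 4 * x ^ 4)"
      using C(2) by (intro mult_right_mono) (auto simp: x_def)
    also have "\<dots> = (C * norm (y s) * x) ^ 4" by (simp add: power_mult_distrib)
    finally have "norm (y t) ^ 4 \<le> (C * norm (y s) * x) ^ 4" .
    then have "norm (y t) \<le> C * norm (y s) * x"
      by (rule iffD1[OF power_mono_iff, rotated -1]) (use C(1) in \<open>auto simp: x_def\<close>)
    then show "norm (y t) \<le> C * norm (y s) * exp ((E t - E s + \<eta> * \<bar>t - s\<bar>) / e)"
      unfolding x_def .
  qed
qed

section \<open>Solutions near the slow curve\<close>

definition fast_field ::
    "(complex \<times> (complex^'n) \<times> complex \<Rightarrow> complex^'n) \<Rightarrow> real \<Rightarrow> real \<Rightarrow> real^'n \<Rightarrow> real^'n" where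
  "fast_field f e t x = (1 / e) *\<^sub>R real_rhs f t x e"

definition real_slice :: "(complex \<times> (complex^'n) \<times> complex) set \<Rightarrow> real \<Rightarrow> (real \<times> (real^'n)) set" where
  "real_slice D e = {(t, x). real_point t x e \<in> D}"

lemma solution_on_iff_ode_solution:
  assumes real: "real_on_reals f D"
    and "e \<noteq> 0"
  shows "solution_on f D e J X \<longleftrightarrow> ode_solution (real_slice D e) (fast_field f e) J X"
proof -
  have scale: "complex_of_real e *s complex_vec v = complex_vec (e *\<^sub>R v)" for v :: "real^'a"
    by (simp add: complex_vec_def vec_eq_iff)
  have "(\<exists>X'. (X has_vector_derivative X') (at t) \<and> complex_of_real e *s complex_vec X' = f (real_point t (X t) e))
      \<longleftrightarrow> (X has_vector_derivative fast_field f e t (X t)) (at t)"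
    if "real_point t (X t) e \<in> D" for t
  proof -
    have "\<exists>y. f (real_point t (X t) e) = complex_vec y" using real that unfolding real_on_reals_def by blast
    then obtain y where y: "f (real_point t (X t) e) = complex_vec y" by blast
    then have ff: "fast_field f e t (X t) = (1 / e) *\<^sub>R y"
      by (simp add: fast_field_def real_rhs_def Re_vec_complex_vec)
    have "complex_of_real e *s complex_vec X' = f (real_point t (X t) e) \<longleftrightarrow> X' = (1 / e) *\<^sub>R y" for X'
    proof -
      have "complex_vec (e *\<^sub>R X') = complex_vec y \<longleftrightarrow> e *\<^sub>R X' = y"
        using Re_vec_complex_vec by metis
      then show ?thesis using \<open>e \<noteq> 0\<close> unfolding y scale by auto
    qed
    then show ?thesis unfolding ff by auto
  qed
  then have "(\<forall>t\<in>J. real_point t (X t) e \<in> D \<and> (\<exists>X'. (X has_vector_derivative X') (at t) \<and>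
        complex_of_real e *s complex_vec X' = f (real_point t (X t) e))) \<longleftrightarrow>
      (\<forall>t\<in>J. (t, X t) \<in> real_slice D e \<and> (X has_vector_derivative fast_field f e t (X t)) (at t))"
    unfolding real_slice_def mem_Collect_eq case_prod_conv by blast
  then show ?thesis
    unfolding solution_on_def ode_solution_def real_point_def[symmetric] by simp
qed

lemma maximal_solution_on_iff_maximal_ode_solution:
  assumes "real_on_reals f D" "e \<noteq> 0"
  shows "maximal_solution_on f D e J X \<longleftrightarrow> maximal_ode_solution (real_slice D e) (fast_field f e) J X"
  unfolding maximal_solution_on_def maximal_ode_solution_def
  by (simp add: solution_on_iff_ode_solution[OF assms])

lemma tame_on_tube_fast_field:
  fixes f :: "complex \<times> (complex^'n) \<times> complex \<Rightarrow> complex^'n" and p :: "real \<Rightarrow> real^'n"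
  assumes f: "canalytic_on f D" "open D"
    and p: "continuous_on {c..d} p" "\<And>t. t \<in> {c..d} \<Longrightarrow> real_point t (p t) 0 \<in> D"
  obtains \<delta>0 where "0 < \<delta>0" "\<And>e \<delta>. 0 < e \<Longrightarrow> e \<le> \<delta>0 \<Longrightarrow> \<delta> \<le> \<delta>0 \<Longrightarrow>
    tame_on_tube (real_slice D e) (fast_field f e) {c..d} p \<delta>"
proof -
  let ?A = "\<lambda>t. matrix (X_derivative f t (p t) 0)"
  obtain \<delta>0 where \<delta>0: "0 < \<delta>0"
    "\<And>t x y e. t \<in> {c..d} \<Longrightarrow> norm (x - p t) \<le> \<delta>0 \<Longrightarrow> norm (y - p t) \<le> \<delta>0 \<Longrightarrow> \<bar>e\<bar> \<le> \<delta>0 \<Longrightarrow>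
      real_point t x e \<in> D \<and>
      norm (real_rhs f t x e - real_rhs f t y e - ?A t *v (x - y)) \<le> 1 * norm (x - y)"
    using real_rhs_linearization[OF f p zero_less_one] by metis
  have "\<exists>B. \<forall>t\<in>{c..d}. \<bar>?A t $ j $ k\<bar> \<le> B" for j k
    using compact_imp_bounded[OF compact_continuous_image[OF continuous_on_X_derivative[OF f p] compact_Icc]]
    unfolding bounded_iff by force
  then obtain B where B: "\<And>j k t. t \<in> {c..d} \<Longrightarrow> \<bar>?A t $ j $ k\<bar> \<le> B j k" by metis
  define M where "M = (\<Sum>j\<in>UNIV. \<Sum>k\<in>UNIV. \<bar>B j k\<bar>)"
  have M: "\<bar>?A t $ j $ k\<bar> \<le> M" if "t \<in> {c..d}" for t j k
  proof -
    have "\<bar>?A t $ j $ k\<bar> \<le> \<bar>B j k\<bar>" using B[OF that, of j k] by simp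
    also have "\<dots> \<le> (\<Sum>k\<in>UNIV. \<bar>B j k\<bar>)" by (rule member_le_sum) auto
    also have "\<dots> \<le> M" unfolding M_def by (rule member_le_sum) (auto intro: sum_nonneg)
    finally show ?thesis .
  qed
  define L where "L = real CARD('n) * real CARD('n) * M"
  have L: "norm (?A t *v v) \<le> L * norm v" if "t \<in> {c..d}" for t and v :: "real^'n"
  proof -
    have "norm (?A t *v v) \<le> onorm ((*v) (?A t)) * norm v"
      by (rule onorm) (rule matrix_vector_mul_bounded_linear)
    also have "\<dots> \<le> L * norm v"
      unfolding L_def by (intro mult_right_mono onorm_le_matrix_component M that) auto
    finally show ?thesis .
  qed
  show thesis
  proof (rule that[OF \<delta>0(1)])
    fix e \<delta> :: real assume e: "0 < e" "e \<le> \<delta>0" and "\<delta> \<le> \<delta>0"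
    have tube: "t \<in> {c..d}" "norm (x - p t) \<le> \<delta>0" if "(t, x) \<in> tube {c..d} p \<delta>" for t x
      using that \<open>\<delta> \<le> \<delta>0\<close> by (auto simp: tube_def)
    have inD: "real_point t x e \<in> D" if "(t, x) \<in> tube {c..d} p \<delta>" for t x
      using \<delta>0(2)[of t x x e] tube[OF that] e by auto
    show "tame_on_tube (real_slice D e) (fast_field f e) {c..d} p \<delta>"
      unfolding tame_on_tube_def
    proof (intro conjI exI allI impI)
      show "continuous_on {c..d} p" by (rule p(1))
      show "tube {c..d} p \<delta> \<subseteq> real_slice D e" using inD by (auto simp: real_slice_def)
      have "continuous_on (tube {c..d} p \<delta>) (\<lambda>z. f (real_point (fst z) (snd z) e))"
        by (rule continuous_on_compose2[OF canalytic_on_imp_continuous_on[OF f(1)]])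
          (auto intro!: continuous_on_real_point continuous_intros inD)
      then have "continuous_on (tube {c..d} p \<delta>) (\<lambda>z. (1 / e) *\<^sub>R Re_vec (f (real_point (fst z) (snd z) e)))"
        by (intro continuous_intros bounded_linear.continuous_on[OF bounded_linear_Re_vec])
      then show "continuous_on (tube {c..d} p \<delta>) (\<lambda>(t, x). fast_field f e t x)"
        by (simp add: fast_field_def real_rhs_def case_prod_unfold)
      fix t x y assume tx: "(t, x) \<in> tube {c..d} p \<delta>" and ty: "(t, y) \<in> tube {c..d} p \<delta>"
      have "norm (real_rhs f t x e - real_rhs f t y e) \<le>
          norm (real_rhs f t x e - real_rhs f t y e - ?A t *v (x - y)) + norm (?A t *v (x - y))"
        by (rule order_trans[OF _ norm_triangle_ineq]) simp
      also have "\<dots> \<le> 1 * norm (x - y) + L * norm (x - y)"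
        using \<delta>0(2)[of t x y e] tube[OF tx] tube[OF ty] e L by (intro add_mono) auto
      finally have "(1 / e) * norm (real_rhs f t x e - real_rhs f t y e) \<le> (1 / e) * ((1 + L) * norm (x - y))"
        using e by (intro mult_left_mono) (auto simp: algebra_simps)
      then show "norm (fast_field f e t x - fast_field f e t y) \<le> (1 / e) * (1 + L) * norm (x - y)"
        using e by (simp add: fast_field_def flip: scaleR_diff_right)
    qed
  qed
qed

text \<open>
  The difference of two solutions near the curve solves a linear equation with a small
  perturbation, by the linearization. The constant \<open>C\<close> is harmless: it changes \<open>e ln \<bar>u - u0\<bar>\<close> by the
  small amount \<open>e ln C\<close>.
\<close>

lemma solutions_near_slow_curve_separate:
  fixes f :: "complex \<times> (complex^2) \<times> complex \<Rightarrow> complex^2" and p :: "real \<Rightarrow> real^2" and E :: "real \<Rightarrow> real"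
  defines "A \<equiv> \<lambda>t. matrix (X_derivative f t (p t) 0)"
  assumes f: "canalytic_on f D" "open D"
    and p: "continuous_on {c..d} p" "\<And>t. t \<in> {c..d} \<Longrightarrow> real_point t (p t) 0 \<in> D"
    and rot: "\<And>t. t \<in> {c..d} \<Longrightarrow> ((A t $ 1 $ 1 - A t $ 2 $ 2) / 2)\<^sup>2 + A t $ 1 $ 2 * A t $ 2 $ 1 < 0"
    and E: "\<And>t. t \<in> {c..d} \<Longrightarrow>
      (E has_real_derivative (A t $ 1 $ 1 + A t $ 2 $ 2) / 2) (at t within {c..d})"
    and "0 < \<eta>"
  obtains C \<delta> where "0 < C" "0 < \<delta>"
    "\<And>e J u J0 u0 s t. 0 < e \<Longrightarrow> e \<le> \<delta> \<Longrightarrow>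
      ode_solution (real_slice D e) (fast_field f e) J u \<Longrightarrow>
      ode_solution (real_slice D e) (fast_field f e) J0 u0 \<Longrightarrow>
      closed_segment s t \<subseteq> J \<inter> J0 \<inter> {c..d} \<Longrightarrow>
      (\<And>r. r \<in> closed_segment s t \<Longrightarrow> norm (u r - p r) \<le> \<delta> \<and> norm (u0 r - p r) \<le> \<delta>) \<Longrightarrow>
      norm (u t - u0 t) \<le> C * norm (u s - u0 s) * exp ((E t - E s + \<eta> * \<bar>t - s\<bar>) / e)"
proof -
  have A: "continuous_on {c..d} (\<lambda>t. A t $ j $ k)" for j k
    unfolding A_def by (rule continuous_on_X_derivative[OF f p])
  obtain C \<theta> e0 where C: "0 < C" "0 < \<theta>" "0 < e0" and growth:
    "\<And>e s1 s2 y y' s t. 0 < e \<Longrightarrow> e \<le> e0 \<Longrightarrow> {s1..s2} \<subseteq> {c..d} \<Longrightarrow>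
      (\<And>t. t \<in> {s1..s2} \<Longrightarrow> (y has_vector_derivative y' t) (at t)) \<Longrightarrow>
      (\<And>t. t \<in> {s1..s2} \<Longrightarrow> norm (e *\<^sub>R y' t - A t *v y t) \<le> \<theta> * norm (y t)) \<Longrightarrow>
      s \<in> {s1..s2} \<Longrightarrow> t \<in> {s1..s2} \<Longrightarrow>
      norm (y t) \<le> C * norm (y s) * exp ((E t - E s + \<eta> * \<bar>t - s\<bar>) / e)"
    by (rule linear_ode_growth[OF A rot E \<open>0 < \<eta>\<close>]) blast+
  obtain \<delta>0 where \<delta>0: "0 < \<delta>0"
    "\<And>t x y e. t \<in> {c..d} \<Longrightarrow> norm (x - p t) \<le> \<delta>0 \<Longrightarrow> norm (y - p t) \<le> \<delta>0 \<Longrightarrow> \<bar>e\<bar> \<le> \<delta>0 \<Longrightarrow>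
      norm (real_rhs f t x e - real_rhs f t y e - A t *v (x - y)) \<le> \<theta> * norm (x - y)"
    using real_rhs_linearization[OF f p C(2)] unfolding A_def by metis
  show thesis
  proof (rule that[of C "min \<delta>0 e0"])
    fix e J u J0 u0 s t
    assume e: "0 < e" "e \<le> min \<delta>0 e0"
      and u: "ode_solution (real_slice D e) (fast_field f e) J u"
      and u0: "ode_solution (real_slice D e) (fast_field f e) J0 u0"
      and seg: "closed_segment s t \<subseteq> J \<inter> J0 \<inter> {c..d}"
      and near: "\<And>r. r \<in> closed_segment s t \<Longrightarrow>
        norm (u r - p r) \<le> min \<delta>0 e0 \<and> norm (u0 r - p r) \<le> min \<delta>0 e0"
    have ivl: "closed_segment s t = {min s t..max s t}"
      by (simp add: closed_segment_eq_real_ivl min_def max_def)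
    show "norm (u t - u0 t) \<le> C * norm (u s - u0 s) * exp ((E t - E s + \<eta> * \<bar>t - s\<bar>) / e)"
    proof (rule growth[of e "min s t" "max s t" "\<lambda>r. u r - u0 r" "\<lambda>r. fast_field f e r (u r) - fast_field f e r (u0 r)"])
      show "0 < e" "e \<le> e0" using e by auto
      show "{min s t..max s t} \<subseteq> {c..d}" using seg unfolding ivl by blast
      fix r assume "r \<in> {min s t..max s t}"
      then have r: "r \<in> closed_segment s t" unfolding ivl .
      then have "r \<in> J" "r \<in> J0" "r \<in> {c..d}" using seg by blast+
      then show "((\<lambda>r. u r - u0 r) has_vector_derivative fast_field f e r (u r) - fast_field f e r (u0 r)) (at r)"
        using u u0 by (intro has_vector_derivative_diff) (auto simp: ode_solution_def)
      have "e *\<^sub>R (fast_field f e r (u r) - fast_field f e r (u0 r)) = real_rhs f r (u r) e - real_rhs f r (u0 r) e"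
        using e by (simp add: fast_field_def flip: scaleR_diff_right)
      then show "norm (e *\<^sub>R (fast_field f e r (u r) - fast_field f e r (u0 r)) - A r *v (u r - u0 r))
          \<le> \<theta> * norm (u r - u0 r)"
        using \<delta>0(2)[OF \<open>r \<in> {c..d}\<close>, of "u r" "u0 r" e] near[OF r] e by simp
    qed auto
  qed (use C \<delta>0 in auto)
qed

lemma exp_minus_divide_le:
  fixes \<gamma> e :: real assumes "0 < \<gamma>" "0 < e" shows "exp (- \<gamma> / e) \<le> e / \<gamma>"
proof -
  have "\<gamma> / e \<le> exp (\<gamma> / e)" using exp_ge_add_one_self[of "\<gamma> / e"] by linarith
  then have "inverse (exp (\<gamma> / e)) \<le> inverse (\<gamma> / e)" using assms by (intro le_imp_inverse_le) auto
  then show ?thesis by (simp add: exp_minus)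
qed

text \<open>
  Growth by at most the factor \<open>exp (\<gamma> / (2 e))\<close> cannot bring a difference of size \<open>exp (- \<gamma> / e)\<close> to a
  standard size, so the solution \<open>u\<close> neither leaves the tube nor stops before \<open>t2\<close>. The time \<open>t2\<close> may
  lie on either side of \<open>t1\<close>.
\<close>

lemma exponentially_close_solution_stays:
  fixes f :: "complex \<times> (complex^2) \<times> complex \<Rightarrow> complex^2" and p :: "real \<Rightarrow> real^2" and E :: "real \<Rightarrow> real"
  defines "A \<equiv> \<lambda>t. matrix (X_derivative f t (p t) 0)"
  assumes f: "canalytic_on f D" "open D"
    and p: "continuous_on {c..d} p" "\<And>t. t \<in> {c..d} \<Longrightarrow> real_point t (p t) 0 \<in> D"
    and rot: "\<And>t. t \<in> {c..d} \<Longrightarrow> ((A t $ 1 $ 1 - A t $ 2 $ 2) / 2)\<^sup>2 + A t $ 1 $ 2 * A t $ 2 $ 1 < 0"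
    and E: "\<And>t. t \<in> {c..d} \<Longrightarrow>
      (E has_real_derivative (A t $ 1 $ 1 + A t $ 2 $ 2) / 2) (at t within {c..d})"
    and "0 < \<eta>" "0 < \<gamma>" "0 < r" and t12: "t1 \<in> {c<..<d}" "t2 \<in> {c<..<d}"
    and E_le: "\<And>t. t \<in> closed_segment t1 t2 \<Longrightarrow> E t - E t1 + \<eta> * \<bar>t - t1\<bar> \<le> \<gamma> / 2"
  obtains \<delta> where "0 < \<delta>"
    "\<And>e J u J0 u0. 0 < e \<Longrightarrow> e < \<delta> \<Longrightarrow>
      maximal_ode_solution (real_slice D e) (fast_field f e) J u \<Longrightarrow>
      ode_solution (real_slice D e) (fast_field f e) J0 u0 \<Longrightarrow>
      (\<And>t. t \<in> closed_segment t1 t2 \<Longrightarrow> t \<in> J0 \<and> norm (u0 t - p t) < \<delta>) \<Longrightarrow>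
      t1 \<in> J \<Longrightarrow> norm (u t1 - u0 t1) \<le> exp (- \<gamma> / e) \<Longrightarrow>
      closed_segment t1 t2 \<subseteq> J \<and> (\<forall>t\<in>closed_segment t1 t2. norm (u t - p t) < r)"
proof -
  obtain C \<delta>1 where C: "0 < C" "0 < \<delta>1" and separate:
    "\<And>e J u J0 u0 s t. 0 < e \<Longrightarrow> e \<le> \<delta>1 \<Longrightarrow>
      ode_solution (real_slice D e) (fast_field f e) J u \<Longrightarrow>
      ode_solution (real_slice D e) (fast_field f e) J0 u0 \<Longrightarrow>
      closed_segment s t \<subseteq> J \<inter> J0 \<inter> {c..d} \<Longrightarrow>
      (\<And>r. r \<in> closed_segment s t \<Longrightarrow> norm (u r - p r) \<le> \<delta>1 \<and> norm (u0 r - p r) \<le> \<delta>1) \<Longrightarrow>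
      norm (u t - u0 t) \<le> C * norm (u s - u0 s) * exp ((E t - E s + \<eta> * \<bar>t - s\<bar>) / e)"
    by (rule solutions_near_slow_curve_separate[OF f p rot[unfolded A_def] E[unfolded A_def] \<open>0 < \<eta>\<close>]) blast+
  obtain \<delta>2 where \<delta>2: "0 < \<delta>2" "\<And>e \<delta>. 0 < e \<Longrightarrow> e \<le> \<delta>2 \<Longrightarrow> \<delta> \<le> \<delta>2 \<Longrightarrow>
    tame_on_tube (real_slice D e) (fast_field f e) {c..d} p \<delta>"
    by (rule tame_on_tube_fast_field[OF f p]) blast+
  define \<rho> where "\<rho> = min r (min \<delta>1 \<delta>2)"
  have \<rho>: "0 < \<rho>" "\<rho> \<le> r" "\<rho> \<le> \<delta>1" "\<rho> \<le> \<delta>2" using \<open>0 < r\<close> C(2) \<delta>2(1) by (auto simp: \<rho>_def)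
  \<comment> \<open>As \<open>exp (- x) \<le> 1 / x\<close>, these bounds on \<open>e\<close> give \<open>exp (- \<gamma> / e) \<le> \<rho> / 8\<close> and
    \<open>C * exp (- \<gamma> / (2 * e)) \<le> \<rho> / 4\<close>.\<close>
  define \<delta> where "\<delta> = min (\<rho> / 4) (min (\<rho> * \<gamma> / 8) (\<rho> * \<gamma> / (8 * C)))"
  have \<delta>: "0 < \<delta>" "\<delta> \<le> \<rho> / 4" "\<delta> \<le> \<rho> * \<gamma> / 8" "\<delta> \<le> \<rho> * \<gamma> / (8 * C)"
  proof -
    show "0 < \<delta>" using \<rho>(1) \<open>0 < \<gamma>\<close> C(1) by (simp add: \<delta>_def)
    show "\<delta> \<le> \<rho> / 4" "\<delta> \<le> \<rho> * \<gamma> / 8" "\<delta> \<le> \<rho> * \<gamma> / (8 * C)" unfolding \<delta>_def by linarith+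
  qed
  have seg_cd: "closed_segment t1 t2 \<subseteq> {c..d}" using t12 by (auto simp: closed_segment_eq_real_ivl)
  show thesis
  proof (rule that[OF \<delta>(1)])
    fix e J u J0 u0
    assume e: "0 < e" "e < \<delta>"
      and u: "maximal_ode_solution (real_slice D e) (fast_field f e) J u"
      and u0: "ode_solution (real_slice D e) (fast_field f e) J0 u0"
      and near: "\<And>t. t \<in> closed_segment t1 t2 \<Longrightarrow> t \<in> J0 \<and> norm (u0 t - p t) < \<delta>"
      and t1: "t1 \<in> J" "norm (u t1 - u0 t1) \<le> exp (- \<gamma> / e)"
    have sol: "ode_solution (real_slice D e) (fast_field f e) J u"
      using u by (simp add: maximal_ode_solution_def)
    have e_le: "e \<le> \<delta>1" "e \<le> \<delta>2" using e \<delta> \<rho> by linarith+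
    have "e / \<gamma> \<le> \<rho> / 8" using e \<delta>(3) \<open>0 < \<gamma>\<close> by (simp add: field_simps)
    then have start: "norm (u t1 - u0 t1) \<le> \<rho> / 8"
      using t1(2) exp_minus_divide_le[OF \<open>0 < \<gamma>\<close> e(1)] by linarith
    have tri: "norm (u t - p t) \<le> norm (u t - u0 t) + norm (u0 t - p t)" for t
      using norm_triangle_ineq[of "u t - u0 t" "u0 t - p t"] by simp
    have "norm (u t1 - p t1) < \<rho>"
      using tri[of t1] start near[of t1] \<delta>(2) \<rho>(1) by auto
    moreover have "norm (u t - p t) \<le> \<rho> / 2"
      if t: "t \<in> closed_segment t1 t2" "closed_segment t1 t \<subseteq> J"
        "\<And>s. s \<in> closed_segment t1 t \<Longrightarrow> norm (u s - p s) < \<rho>" for t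
    proof -
      have sub: "closed_segment t1 t \<subseteq> closed_segment t1 t2"
        using t(1) by (simp add: subset_closed_segment)
      have "norm (u t - u0 t) \<le> C * norm (u t1 - u0 t1) * exp ((E t - E t1 + \<eta> * \<bar>t - t1\<bar>) / e)"
      proof (rule separate[OF e(1) e_le(1) sol u0])
        show "closed_segment t1 t \<subseteq> J \<inter> J0 \<inter> {c..d}" using t(2) sub near seg_cd by blast
        fix s assume s: "s \<in> closed_segment t1 t"
        then have "norm (u0 s - p s) < \<delta>" using near sub by blast
        then show "norm (u s - p s) \<le> \<delta>1 \<and> norm (u0 s - p s) \<le> \<delta>1"
          using t(3)[OF s] \<rho> \<delta>(2) by linarith
      qed
      also have "\<dots> \<le> C * exp (- \<gamma> / e) * exp ((\<gamma> / 2) / e)"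
        using t1(2) divide_right_mono[OF E_le[OF t(1)], of e] C(1) e(1) by (intro mult_mono) auto
      also have "\<dots> = C * exp (- (\<gamma> / 2) / e)" by (simp add: mult.assoc field_simps flip: exp_add)
      also have "\<dots> \<le> C * (e / (\<gamma> / 2))"
        using C(1) exp_minus_divide_le[of "\<gamma> / 2" e] e(1) \<open>0 < \<gamma>\<close> by (intro mult_left_mono) auto
      also have "\<dots> \<le> C * (\<rho> * \<gamma> / (8 * C) / (\<gamma> / 2))"
        using C(1) e \<delta>(4) \<open>0 < \<gamma>\<close> by (intro mult_left_mono divide_right_mono) auto
      also have "\<dots> = \<rho> / 4" using C(1) \<open>0 < \<gamma>\<close> by (simp add: field_simps)
      finally show ?thesis using tri[of t] near[OF t(1)] \<delta>(2) by linarith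
    qed
    ultimately have "closed_segment t1 t2 \<subseteq> J"
      "\<And>t. t \<in> closed_segment t1 t2 \<Longrightarrow> norm (u t - p t) \<le> \<rho> / 2"
      using maximal_ode_solution_trapped[OF u \<delta>2(2)[OF e(1) e_le(2) \<rho>(4)] t12 t1(1), of "\<rho> / 2"] \<rho>(1) by auto
    then show "closed_segment t1 t2 \<subseteq> J \<and> (\<forall>t\<in>closed_segment t1 t2. norm (u t - p t) < r)"
      using \<rho> by force
  qed
qed

section \<open>Uniform closeness and internal points\<close>

lemma ultrafilter_not_eventually:
  assumes "ultrafilter F" "\<not> eventually P F" shows "\<forall>\<^sub>F i in F. \<not> P i"
  using assms unfolding ultrafilter_def by blast

lemma ultrafilter_eventually_const:
  assumes "ultrafilter F" "\<forall>\<^sub>F i in F. P" shows P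
  using assms unfolding ultrafilter_def by (simp add: eventually_const)

text \<open>
  An internal statement holds on an internal set as soon as it holds at all its internal points,
  since a counterexample at almost all indices can be chosen as one internal point.
\<close>

lemma ultrafilter_eventually_all:
  assumes F: "ultrafilter F"
    and *: "\<And>x. \<forall>\<^sub>F i in F. x i \<in> A \<Longrightarrow> \<forall>\<^sub>F i in F. P i (x i)"
  shows "\<forall>\<^sub>F i in F. \<forall>x\<in>A. P i x"
proof (rule ccontr)
  assume "\<not> ?thesis"
  from ultrafilter_not_eventually[OF F this]
  have ex: "\<forall>\<^sub>F i in F. \<exists>x. x \<in> A \<and> \<not> P i x" by (simp add: Bex_def)
  define x where "x i = (SOME x. x \<in> A \<and> \<not> P i x)" for i
  have x: "\<forall>\<^sub>F i in F. x i \<in> A \<and> \<not> P i (x i)"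
    using ex by (rule eventually_mono) (unfold x_def, rule someI_ex)
  then have "\<forall>\<^sub>F i in F. P i (x i)" by (intro *) (auto elim: eventually_mono)
  with x have "\<forall>\<^sub>F i in F. False" by eventually_elim auto
  then show False using F by (simp add: ultrafilter_def)
qed

text \<open>
  Every internal point of a compact interval inside the open one belongs to the \<open>S\<close>-interior.
\<close>

lemma goes_along_at_least_uniformly:
  assumes F: "ultrafilter F" and along: "goes_along_at_least F Dt \<phi> J X t1 t2"
    and ab: "t1 < ereal a" "ereal b < t2" and "0 < r"
  shows "\<forall>\<^sub>F i in F. \<forall>t\<in>{a..b}. t \<in> J i \<and> norm (complex_vec (X i t) - \<phi> (complex_of_real t)) < r"
proof (rule ultrafilter_eventually_all[OF F])
  fix t assume t: "\<forall>\<^sub>F i in F. t i \<in> {a..b}"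
  have "t \<in> S_interior F t1 t2"
    unfolding S_interior_def
  proof (intro CollectI conjI allI impI notI)
    have "\<forall>\<^sub>F i in F. norm (t i) \<le> \<bar>a\<bar> + \<bar>b\<bar>"
      using t by (rule eventually_mono) auto
    then show "limited F t" unfolding limited_def by blast
    show "\<forall>\<^sub>F i in F. t1 < ereal (t i) \<and> ereal (t i) < t2"
      using t
    proof (rule eventually_mono)
      fix i assume "t i \<in> {a..b}"
      then have "ereal a \<le> ereal (t i)" "ereal (t i) \<le> ereal b" by auto
      with ab show "t1 < ereal (t i) \<and> ereal (t i) < t2" by (meson less_le_trans le_less_trans)
    qed
    fix s assume s: "ereal s = t1 \<or> ereal s = t2" and close: "infinitely_close F t (\<lambda>i. s)"
    define q where "q = (if s < a then a - s else s - b)"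
    show False
    proof (cases "{a..b} = {}")
      case True
      with t have "\<forall>\<^sub>F i in F. False" by simp
      then show False by (rule ultrafilter_eventually_const[OF F])
    next
      case False
      have s': "s < a \<or> b < s" using s ab by auto
      then have "q > 0" using False by (auto simp: q_def)
      then have "\<forall>\<^sub>F i in F. norm (t i - s) < q"
        using close unfolding infinitely_close_def infinitesimal_def by blast
      with t have "\<forall>\<^sub>F i in F. False"
        by eventually_elim (use s' in \<open>auto simp: q_def split: if_splits\<close>)
      then show False by (rule ultrafilter_eventually_const[OF F])
    qed
  qed
  with along have "\<forall>\<^sub>F i in F. t i \<in> J i \<and> complex_of_real (t i) \<in> Dt"
    "\<forall>\<^sub>F i in F. norm (complex_vec (X i (t i)) - \<phi> (complex_of_real (t i))) < r"
    using \<open>0 < r\<close> unfolding goes_along_at_least_def infinitely_close_def infinitesimal_def by blast+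
  then show "\<forall>\<^sub>F i in F. t i \<in> J i \<and> norm (complex_vec (X i (t i)) - \<phi> (complex_of_real (t i))) < r"
    by eventually_elim simp
qed

text \<open>
  A point of the \<open>S\<close>-interior has a standard distance from both ends, hence lies in a standard
  compact interval.
\<close>

lemma goes_along_at_leastI:
  fixes t1 t2 :: real
  assumes F: "ultrafilter F"
    and Dt: "\<And>t. t1 < t \<Longrightarrow> t < t2 \<Longrightarrow> complex_of_real t \<in> Dt"
    and unif: "\<And>a b r. t1 < a \<Longrightarrow> b < t2 \<Longrightarrow> 0 < r \<Longrightarrow>
      \<forall>\<^sub>F i in F. \<forall>t\<in>{a..b}. t \<in> J i \<and> norm (complex_vec (X i t) - \<phi> (complex_of_real t)) < r"
  shows "goes_along_at_least F Dt \<phi> J X (ereal t1) (ereal t2)"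
  unfolding goes_along_at_least_def
proof
  fix t assume t: "t \<in> S_interior F (ereal t1) (ereal t2)"
  have away: "\<exists>q>0. \<forall>\<^sub>F i in F. q \<le> \<bar>t i - s\<bar>" if "s = t1 \<or> s = t2" for s
  proof -
    have "\<not> infinitely_close F t (\<lambda>i. s)" using t that by (auto simp: S_interior_def)
    then obtain q where "q > 0" "\<not> (\<forall>\<^sub>F i in F. norm (t i - s) < q)"
      unfolding infinitely_close_def infinitesimal_def by blast
    with ultrafilter_not_eventually[OF F this(2)] show ?thesis by (auto simp: not_less)
  qed
  obtain q1 where q1: "q1 > 0" "\<forall>\<^sub>F i in F. q1 \<le> \<bar>t i - t1\<bar>" using away[of t1] by blast
  obtain q2 where q2: "q2 > 0" "\<forall>\<^sub>F i in F. q2 \<le> \<bar>t i - t2\<bar>" using away[of t2] by blast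
  have inside: "\<forall>\<^sub>F i in F. t1 < t i \<and> t i < t2" using t by (simp add: S_interior_def)
  have ivl: "\<forall>\<^sub>F i in F. t i \<in> {t1 + q1..t2 - q2}"
    using inside q1(2) q2(2) by eventually_elim auto
  have near: "\<forall>\<^sub>F i in F. t i \<in> J i \<and> norm (complex_vec (X i (t i)) - \<phi> (complex_of_real (t i))) < r"
    if "0 < r" for r
    using unif[of "t1 + q1" "t2 - q2" r] q1(1) q2(1) that ivl by (auto elim: eventually_elim2)
  have "\<forall>\<^sub>F i in F. t i \<in> J i \<and> complex_of_real (t i) \<in> Dt"
    using near[OF zero_less_one] inside by eventually_elim (use Dt in auto)
  moreover have "infinitely_close F (\<lambda>i. complex_vec (X i (t i))) (\<lambda>i. \<phi> (complex_of_real (t i)))"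
    unfolding infinitely_close_def infinitesimal_def
  proof (intro allI impI)
    fix r :: real assume "0 < r"
    from near[OF this]
    show "\<forall>\<^sub>F i in F. norm (complex_vec (X i (t i)) - \<phi> (complex_of_real (t i))) < r"
      by eventually_elim simp
  qed
  ultimately show "(\<forall>\<^sub>F i in F. t i \<in> J i \<and> complex_of_real (t i) \<in> Dt) \<and>
      infinitely_close F (\<lambda>i. complex_vec (X i (t i))) (\<lambda>i. \<phi> (complex_of_real (t i)))" ..
qed

text \<open>
  At a standard time the value of the slow curve is infinitely close to real vectors.
\<close>

lemma slow_curve_real:
  assumes F: "ultrafilter F" and along: "goes_along_at_least F Dt \<phi> J X t1 t2"
    and t: "t1 < ereal t" "ereal t < t2"
  shows "\<phi> (complex_of_real t) = complex_vec (Re_vec (\<phi> (complex_of_real t)))"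
proof -
  have "Im (\<phi> (complex_of_real t) $ k) = 0" for k
  proof (rule ccontr)
    let ?im = "\<bar>Im (\<phi> (complex_of_real t) $ k)\<bar>"
    assume "Im (\<phi> (complex_of_real t) $ k) \<noteq> 0"
    then have "0 < ?im" by simp
    from goes_along_at_least_uniformly[OF F along t this]
    have "\<forall>\<^sub>F i in F. norm (complex_vec (X i t) - \<phi> (complex_of_real t)) < ?im"
      by (rule eventually_mono) simp
    then have "\<forall>\<^sub>F i in F. False"
    proof (rule eventually_mono)
      fix i assume *: "norm (complex_vec (X i t) - \<phi> (complex_of_real t)) < ?im"
      have "?im = \<bar>Im ((complex_vec (X i t) - \<phi> (complex_of_real t)) $ k)\<bar>"
        by (simp add: complex_vec_def)
      also have "\<dots> \<le> norm (complex_vec (X i t) - \<phi> (complex_of_real t))"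
        by (rule order_trans[OF abs_Im_le_cmod Finite_Cartesian_Product.norm_nth_le])
      finally show False using * by simp
    qed
    then show False by (rule ultrafilter_eventually_const[OF F])
  qed
  then show ?thesis
    by (simp add: complex_vec_def Re_vec_def vec_eq_iff complex_eq_iff)
qed

section \<open>The entrance-exit relation\<close>

theorem proposition1:
  fixes F :: "'i filter"
    and f :: "complex \<times> (complex^2) \<times> complex \<Rightarrow> complex^2"
    and D :: "(complex \<times> (complex^2) \<times> complex) set"
    and \<phi> :: "complex \<Rightarrow> complex^2" and Dt :: "complex set"
    and tm tM :: ereal and a te ts :: real
    and lam mu :: "real \<Rightarrow> complex"
    and \<epsilon> :: "'i \<Rightarrow> real"
    and J0 J :: "'i \<Rightarrow> real set" and X0 X :: "'i \<Rightarrow> real \<Rightarrow> real^2"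
  assumes F: "ultrafilter F"
    and H1_domain: "open D" "connected D"
    and H1_analytic: "canalytic_on f D"
    and H1_real: "\<And>t x e. (complex_of_real t, complex_vec x, complex_of_real e) \<in> D \<Longrightarrow>
        \<exists>y. f (complex_of_real t, complex_vec x, complex_of_real e) = complex_vec y"
    and H2: "\<forall>\<^sub>F i in F. \<epsilon> i > 0" "infinitesimal F \<epsilon>"
    and H3_domain: "open Dt" "connected Dt"
    and H3_analytic: "\<And>k. (\<lambda>t. \<phi> t $ k) analytic_on Dt"
    and H3_slow_curve: "\<And>t. t \<in> Dt \<Longrightarrow> (t, \<phi> t, 0) \<in> D \<and> f (t, \<phi> t, 0) = 0"
    and H3_interval: "{t. complex_of_real t \<in> Dt} = {t. tm < ereal t \<and> ereal t < tM}"
    and H4_eigenvalues: "\<And>t. tm < ereal t \<Longrightarrow> ereal t < tM \<Longrightarrow>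
        eigenvalues (jacobian_X f (complex_of_real t) (\<phi> (complex_of_real t)) 0) = {lam t, mu t}"
    and H4_a: "tm < ereal a" "ereal a < tM"
    and H4_before: "\<And>t. tm < ereal t \<Longrightarrow> t < a \<Longrightarrow> Re (lam t) < 0 \<and> Re (mu t) < 0"
    and H4_at: "Re (lam a) = 0" "Re (mu a) = 0"
    and H4_after: "\<And>t. a < t \<Longrightarrow> ereal t < tM \<Longrightarrow> Re (lam t) > 0 \<and> Re (mu t) > 0"
    and H4_Im: "\<And>t. tm < ereal t \<Longrightarrow> ereal t < tM \<Longrightarrow> Im (lam t) < 0 \<and> 0 < Im (mu t)"
    and X0_solution: "\<forall>\<^sub>F i in F. solution_on f D (\<epsilon> i) (J0 i) (X0 i)"
    and X0_along: "goes_along_at_least F Dt \<phi> J0 X0 tm tM"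
    and X_solution: "\<forall>\<^sub>F i in F. maximal_solution_on f D (\<epsilon> i) (J i) (X i)"
    and X_along: "goes_along_exactly F Dt \<phi> J X (ereal te) (ereal ts)"
    and te_ts: "te < ts" "tm < ereal te" "ereal ts < tM"
  shows "((\<lambda>\<tau>. Re (lam \<tau>)) has_integral 0) {te..ts}"
proof -
  \<comment> \<open>A compact interval that contains \<open>{te..ts}\<close> in its interior carries all uniform estimates.\<close>
  obtain c where c: "tm < ereal c" "c < te" using ereal_dense2[OF te_ts(2)] by auto
  obtain d where d: "ts < d" "ereal d < tM" using ereal_dense2[OF te_ts(3)] by auto
  have cd: "tm < ereal t \<and> ereal t < tM" if "t \<in> {c..d}" for t
  proof -
    from that have "ereal c \<le> ereal t" "ereal t \<le> ereal d" by auto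
    with c(1) d(2) show ?thesis by (meson less_le_trans le_less_trans)
  qed
  have Dt: "complex_of_real t \<in> Dt" if "t \<in> {c..d}" for t
    using cd[OF that] H3_interval by blast
  define p where "p t = Re_vec (\<phi> (complex_of_real t))" for t
  have \<phi>: "\<phi> (complex_of_real t) = complex_vec (p t)" if "t \<in> {c..d}" for t
    unfolding p_def using slow_curve_real[OF F X0_along] cd[OF that] by blast
  define A where "A t = matrix (X_derivative f t (p t) 0)" for t
  define \<alpha> where "\<alpha> t = (A t $ 1 $ 1 + A t $ 2 $ 2) / 2" for t
  define E where "E t = integral {c..t} \<alpha>" for t
  have real: "real_on_reals f D"
    unfolding real_on_reals_def real_point_def using H1_real by blast
  have p: "continuous_on {c..d} p"
  proof -
    have "continuous_on {c..d} (\<lambda>t. \<phi> (complex_of_real t) $ k)" for k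
      by (rule continuous_on_compose2[OF holomorphic_on_imp_continuous_on[OF
            analytic_imp_holomorphic[OF H3_analytic]]])
        (use Dt in \<open>auto intro!: continuous_intros\<close>)
    then show ?thesis
      unfolding p_def Re_vec_def by (intro continuous_on_vec_lambda continuous_on_Re)
  qed
  have pD: "real_point t (p t) 0 \<in> D" if "t \<in> {c..d}" for t
    using H3_slow_curve[OF Dt[OF that]] \<phi>[OF that] by (simp add: real_point_def)
  note f = H1_analytic H1_domain(1)
  have eig: "Re (lam t) = \<alpha> t" "((A t $ 1 $ 1 - A t $ 2 $ 2) / 2)\<^sup>2 + A t $ 1 $ 2 * A t $ 2 $ 1 < 0"
    if "t \<in> {c..d}" for t
  proof -
    let ?M = "jacobian_X f (complex_of_real t) (\<phi> (complex_of_real t)) 0"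
    have M: "?M $ j $ k = complex_of_real (A t $ j $ k)" for j k
      using jacobian_X_eq[OF f pD[OF that] real, of j k] \<phi>[OF that] by (simp add: A_def)
    have "lam t \<in> eigenvalues ?M" "Im (lam t) \<noteq> 0"
      using H4_eigenvalues[of t] H4_Im[of t] cd[OF that] by auto
    from eigenvalue_real_matrix_2[OF M this]
    show "Re (lam t) = \<alpha> t" "((A t $ 1 $ 1 - A t $ 2 $ 2) / 2)\<^sup>2 + A t $ 1 $ 2 * A t $ 2 $ 1 < 0"
      by (simp_all add: \<alpha>_def)
  qed
  have \<alpha>_cont: "continuous_on {c..d} \<alpha>"
    unfolding \<alpha>_def A_def by (intro continuous_intros continuous_on_X_derivative[OF f p pD]; simp)
  have E: "(E has_real_derivative (A t $ 1 $ 1 + A t $ 2 $ 2) / 2) (at t within {c..d})"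
    if "t \<in> {c..d}" for t
    using integral_has_real_derivative[OF \<alpha>_cont that] unfolding E_def \<alpha>_def .
  have E_cont: "continuous_on {c..d} E" using E by (rule DERIV_continuous_on)
  have eps_small: "\<forall>\<^sub>F i in F. 0 < \<epsilon> i \<and> \<epsilon> i < r" if "0 < r" for r
  proof -
    have "\<forall>\<^sub>F i in F. norm (\<epsilon> i) < r" using H2(2) that unfolding infinitesimal_def by blast
    with H2(1) show ?thesis by eventually_elim auto
  qed
  have X0_near: "\<forall>\<^sub>F i in F. \<forall>t\<in>{c..d}. t \<in> J0 i \<and> norm (X0 i t - p t) < r" if "0 < r" for r
    using goes_along_at_least_uniformly[OF F X0_along c(1) d(2) that]
    by (rule eventually_mono) (use \<phi> in \<open>auto simp: complex_vec_diff norm_complex_vec\<close>)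
  have X_near: "\<forall>\<^sub>F i in F. \<forall>t\<in>{a..b}. t \<in> J i \<and> norm (X i t - p t) < r"
    if "0 < r" "te < a" "b < ts" for r a b
  proof -
    have ab: "ereal te < ereal a" "ereal b < ereal ts" using that by auto
    from X_along have "goes_along_at_least F Dt \<phi> J X (ereal te) (ereal ts)"
      by (simp add: goes_along_exactly_def)
    from goes_along_at_least_uniformly[OF F this ab that(1)] show ?thesis
      by (rule eventually_mono)
        (use \<phi> that c(2) d(1) in \<open>auto simp: complex_vec_diff norm_complex_vec\<close>)
  qed
  have X_ode: "\<forall>\<^sub>F i in F. maximal_ode_solution (real_slice D (\<epsilon> i)) (fast_field f (\<epsilon> i)) (J i) (X i)"
    using X_solution H2(1)
    by eventually_elim (simp add: maximal_solution_on_iff_maximal_ode_solution[OF real])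
  have X0_ode: "\<forall>\<^sub>F i in F. ode_solution (real_slice D (\<epsilon> i)) (fast_field f (\<epsilon> i)) (J0 i) (X0 i)"
    using X0_solution H2(1) by eventually_elim (simp add: solution_on_iff_ode_solution[OF real])

  \<comment> \<open>From an exponentially small distance at \<open>t1\<close>, the solution follows the slow curve up to \<open>t2\<close>.\<close>
  have stays: "\<forall>\<^sub>F i in F. \<forall>t\<in>closed_segment t1 t2. t \<in> J i \<and> norm (X i t - p t) < r"
    if t12: "t1 \<in> {c<..<d}" "t2 \<in> {c<..<d}" and "te < t1" "t1 < ts" and "0 < \<gamma>" "0 < r"
      and E_le: "\<And>t. t \<in> closed_segment t1 t2 \<Longrightarrow> E t - E t1 + 1 * \<bar>t - t1\<bar> \<le> \<gamma> / 2"
      and close: "\<forall>\<^sub>F i in F. norm (X i t1 - X0 i t1) \<le> exp (- \<gamma> / \<epsilon> i)"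
    for t1 t2 \<gamma> r
  proof -
    obtain \<delta> where \<delta>: "0 < \<delta>" and stay: "\<And>e J u J0 u0. 0 < e \<Longrightarrow> e < \<delta> \<Longrightarrow>
        maximal_ode_solution (real_slice D e) (fast_field f e) J u \<Longrightarrow>
        ode_solution (real_slice D e) (fast_field f e) J0 u0 \<Longrightarrow>
        (\<And>t. t \<in> closed_segment t1 t2 \<Longrightarrow> t \<in> J0 \<and> norm (u0 t - p t) < \<delta>) \<Longrightarrow>
        t1 \<in> J \<Longrightarrow> norm (u t1 - u0 t1) \<le> exp (- \<gamma> / e) \<Longrightarrow>
        closed_segment t1 t2 \<subseteq> J \<and> (\<forall>t\<in>closed_segment t1 t2. norm (u t - p t) < r)"
      by (rule exponentially_close_solution_stays[OF f p pD eig(2)[unfolded A_def] E[unfolded A_def]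
            zero_less_one \<open>0 < \<gamma>\<close> \<open>0 < r\<close> t12 E_le]) blast+
    have seg: "closed_segment t1 t2 \<subseteq> {c..d}" using t12 by (auto simp: closed_segment_eq_real_ivl)
    have "\<forall>\<^sub>F i in F. t1 \<in> J i"
      using X_near[OF zero_less_one \<open>te < t1\<close> \<open>t1 < ts\<close>] by (rule eventually_mono) simp
    with eps_small[OF \<delta>] X_ode X0_ode X0_near[OF \<delta>] close show ?thesis
    proof eventually_elim
      case (elim i)
      have "closed_segment t1 t2 \<subseteq> J i \<and> (\<forall>t\<in>closed_segment t1 t2. norm (X i t - p t) < r)"
        by (rule stay[of "\<epsilon> i" "J i" "X i" "J0 i" "X0 i"]) (use elim seg in auto)
      then show ?case by blast
    qed
  qed

  \<comment> \<open>Around \<open>\<tau>\<close> the growth exponent is too small to use up the reserve \<open>\<gamma>\<close>.\<close>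
  have near_E: "\<exists>\<sigma>>0. \<forall>t\<in>{\<tau> - \<sigma>..\<tau> + \<sigma>}. \<forall>t'\<in>{\<tau> - \<sigma>..\<tau> + \<sigma>}.
      t \<in> {c<..<d} \<and> E t - E t' + 1 * \<bar>t - t'\<bar> \<le> \<gamma> / 2" if \<tau>: "c < \<tau>" "\<tau> < d" and "0 < \<gamma>" for \<tau> \<gamma>
  proof -
    have "\<tau> \<in> {c..d}" "0 < \<gamma> / 8" using that by auto
    then obtain s where s: "s > 0" "\<And>t. t \<in> {c..d} \<Longrightarrow> dist t \<tau> < s \<Longrightarrow> dist (E t) (E \<tau>) < \<gamma> / 8"
      using E_cont unfolding continuous_on_iff by meson
    define \<sigma> where "\<sigma> = min (s / 2) (min (\<gamma> / 8) (min ((\<tau> - c) / 2) ((d - \<tau>) / 2)))"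
    have \<sigma>: "\<sigma> > 0" "\<sigma> < s" "\<sigma> \<le> \<gamma> / 8" "c < \<tau> - \<sigma>" "\<tau> + \<sigma> < d"
    proof -
      show "\<sigma> > 0" using s(1) \<tau> \<open>0 < \<gamma>\<close> by (simp add: \<sigma>_def)
      have "\<sigma> \<le> s / 2" "\<sigma> \<le> \<gamma> / 8" "\<sigma> \<le> (\<tau> - c) / 2" "\<sigma> \<le> (d - \<tau>) / 2"
        unfolding \<sigma>_def by linarith+
      then show "\<sigma> < s" "\<sigma> \<le> \<gamma> / 8" "c < \<tau> - \<sigma>" "\<tau> + \<sigma> < d"
        using s(1) \<tau> by (simp_all add: field_simps)
    qed
    have at: "t \<in> {c<..<d}" "\<bar>E t - E \<tau>\<bar> < \<gamma> / 8" "\<bar>t - \<tau>\<bar> \<le> \<gamma> / 8"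
      if t: "t \<in> {\<tau> - \<sigma>..\<tau> + \<sigma>}" for t
    proof -
      show "t \<in> {c<..<d}" using t \<sigma>(4,5) by simp
      have "\<bar>t - \<tau>\<bar> \<le> \<sigma>" using t by (simp add: abs_le_iff)
      then show "\<bar>t - \<tau>\<bar> \<le> \<gamma> / 8" "\<bar>E t - E \<tau>\<bar> < \<gamma> / 8"
        using s(2)[of t] \<sigma>(2,3) \<open>t \<in> {c<..<d}\<close> by (auto simp: dist_real_def)
    qed
    have "t \<in> {c<..<d} \<and> E t - E t' + 1 * \<bar>t - t'\<bar> \<le> \<gamma> / 2"
      if "t \<in> {\<tau> - \<sigma>..\<tau> + \<sigma>}" "t' \<in> {\<tau> - \<sigma>..\<tau> + \<sigma>}" for t t'
    proof
      show "E t - E t' + 1 * \<bar>t - t'\<bar> \<le> \<gamma> / 2"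
      proof -
        have "E t - E t' \<le> \<gamma> / 4"
          using at(2)[OF that(1)] at(2)[OF that(2)] by linarith
        moreover have "\<bar>t - t'\<bar> \<le> \<gamma> / 4"
          using at(3)[OF that(1)] at(3)[OF that(2)] by linarith
        ultimately show ?thesis by simp
      qed
    qed (rule at(1)[OF that(1)])
    then show ?thesis using \<sigma>(1) by blast
  qed

  \<comment> \<open>Near an end \<open>\<tau>\<close> of the maximal interval the distance is therefore not exponentially small: otherwise
    the interval could be enlarged up to \<open>T\<close>, which lies beyond \<open>\<tau>\<close>.\<close>
  have far: "\<forall>\<^sub>F i in F. exp (- \<gamma> / \<epsilon> i) < norm (X i t1 - X0 i t1)"
    if \<tau>: "\<tau> = te \<and> T < te \<or> \<tau> = ts \<and> ts < T" and t1: "te < t1" "t1 < ts" and "0 < \<gamma>"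
      and \<sigma>: "\<forall>t\<in>{\<tau> - \<sigma>..\<tau> + \<sigma>}. \<forall>t'\<in>{\<tau> - \<sigma>..\<tau> + \<sigma>}.
        t \<in> {c<..<d} \<and> E t - E t' + 1 * \<bar>t - t'\<bar> \<le> \<gamma> / 2"
      and T: "t1 \<in> {\<tau> - \<sigma>..\<tau> + \<sigma>}" "T \<in> {\<tau> - \<sigma>..\<tau> + \<sigma>}"
    for \<tau> T t1 \<gamma> \<sigma>
  proof (rule ccontr)
    assume "\<not> ?thesis"
    from ultrafilter_not_eventually[OF F this]
    have close: "\<forall>\<^sub>F i in F. norm (X i t1 - X0 i t1) \<le> exp (- \<gamma> / \<epsilon> i)"
      by (simp add: not_less)
    have seg: "closed_segment t1 T \<subseteq> {\<tau> - \<sigma>..\<tau> + \<sigma>}"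
      using T by (auto simp: closed_segment_eq_real_ivl)
    have stays': "\<forall>\<^sub>F i in F. \<forall>t\<in>closed_segment t1 T. t \<in> J i \<and> norm (X i t - p t) < r" if "0 < r" for r
    proof (rule stays[OF _ _ t1 \<open>0 < \<gamma>\<close> that _ close])
      show "t1 \<in> {c<..<d}" "T \<in> {c<..<d}" using \<sigma> T by blast+
      fix t assume "t \<in> closed_segment t1 T"
      with seg \<sigma> T(1) show "E t - E t1 + 1 * \<bar>t - t1\<bar> \<le> \<gamma> / 2" by blast
    qed
    define t1' where "t1' = min te T"
    define t2' where "t2' = max ts T"
    have T_cd: "T \<in> {c<..<d}" using \<sigma> T by blast
    have "goes_along_at_least F Dt \<phi> J X (ereal t1') (ereal t2')"
    proof (rule goes_along_at_leastI[OF F])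
      have in_cd: "t \<in> {c..d}" if "t1' < t" "t < t2'" for t
        using that T_cd c(2) d(1) te_ts(1) by (auto simp: t1'_def t2'_def)
      then show "complex_of_real t \<in> Dt" if "t1' < t" "t < t2'" for t using Dt that by blast
      fix a b r :: real assume ab: "t1' < a" "b < t2'" and "0 < r"
      define a' where "a' = (if T < te then t1 else a)"
      define b' where "b' = (if ts < T then t1 else b)"
      have "te < a'" "b' < ts"
        using \<tau> ab t1 te_ts(1) by (auto simp: a'_def b'_def t1'_def t2'_def min_def max_def split: if_splits)
      from X_near[OF \<open>0 < r\<close> this] stays'[OF \<open>0 < r\<close>]
      show "\<forall>\<^sub>F i in F. \<forall>t\<in>{a..b}. t \<in> J i \<and> norm (complex_vec (X i t) - \<phi> (complex_of_real t)) < r"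
      proof eventually_elim
        case (elim i)
        show ?case
        proof
          fix t assume t: "t \<in> {a..b}"
          have "t \<in> {a'..b'} \<or> t \<in> closed_segment t1 T"
            using t ab \<tau> te_ts(1)
            by (auto simp: a'_def b'_def t1'_def t2'_def closed_segment_eq_real_ivl min_def max_def split: if_splits)
          then have "t \<in> J i \<and> norm (X i t - p t) < r" using elim by blast
          moreover have "\<phi> (complex_of_real t) = complex_vec (p t)"
            using \<phi> in_cd[of t] t ab by simp
          ultimately show "t \<in> J i \<and> norm (complex_vec (X i t) - \<phi> (complex_of_real t)) < r"
            by (simp add: complex_vec_diff norm_complex_vec)
        qed
      qed
    qed
    moreover have "ereal t1' \<le> ereal te" "ereal ts \<le> ereal t2'" by (auto simp: t1'_def t2'_def)
    ultimately have "ereal t1' = ereal te \<and> ereal t2' = ereal ts"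
      using X_along unfolding goes_along_exactly_def by blast
    then show False using \<tau> by (auto simp: t1'_def t2'_def)
  qed

  \<comment> \<open>Between times near the two ends, \<open>\<epsilon> ln \<bar>Y\<bar>\<close> moves from one value in \<open>[- \<gamma>, 0]\<close> to another; the growth
    estimate in both directions turns this into a bound for the integral of \<open>\<alpha>\<close>.\<close>
  have E_close: "\<bar>E ts - E te\<bar> \<le> 4 * \<gamma>" if \<gamma>: "0 < \<gamma>" for \<gamma>
  proof -
    have "c < te" "te < d" "c < ts" "ts < d" using c d te_ts(1) by auto
    obtain \<sigma>e where \<sigma>e: "0 < \<sigma>e" "\<forall>t\<in>{te - \<sigma>e..te + \<sigma>e}. \<forall>t'\<in>{te - \<sigma>e..te + \<sigma>e}.
        t \<in> {c<..<d} \<and> E t - E t' + 1 * \<bar>t - t'\<bar> \<le> \<gamma> / 2"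
      using near_E[OF \<open>c < te\<close> \<open>te < d\<close> \<gamma>] by blast
    obtain \<sigma>s where \<sigma>s: "0 < \<sigma>s" "\<forall>t\<in>{ts - \<sigma>s..ts + \<sigma>s}. \<forall>t'\<in>{ts - \<sigma>s..ts + \<sigma>s}.
        t \<in> {c<..<d} \<and> E t - E t' + 1 * \<bar>t - t'\<bar> \<le> \<gamma> / 2"
      using near_E[OF \<open>c < ts\<close> \<open>ts < d\<close> \<gamma>] by blast
    define t0 where "t0 = te + min \<sigma>e ((ts - te) / 3)"
    define t1 where "t1 = ts - min \<sigma>s ((ts - te) / 3)"
    have t0: "te < t0" "t0 \<le> te + \<sigma>e" and t1: "t1 < ts" "ts - \<sigma>s \<le> t1"
      using \<sigma>e(1) \<sigma>s(1) te_ts(1) by (auto simp: t0_def t1_def)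
    have "t0 \<le> te + (ts - te) / 3" "ts - (ts - te) / 3 \<le> t1"
      unfolding t0_def t1_def by linarith+
    then have "t0 < t1" using te_ts(1) by (simp add: field_simps)
    then have "t0 < ts" "te < t1" using t0 t1 by auto
    have far_t0: "\<forall>\<^sub>F i in F. exp (- \<gamma> / \<epsilon> i) < norm (X i t0 - X0 i t0)"
      by (rule far[of te "te - \<sigma>e" t0 \<gamma> \<sigma>e]) (use t0 \<open>t0 < ts\<close> \<gamma> \<sigma>e in auto)
    have far_t1: "\<forall>\<^sub>F i in F. exp (- \<gamma> / \<epsilon> i) < norm (X i t1 - X0 i t1)"
      by (rule far[of ts "ts + \<sigma>s" t1 \<gamma> \<sigma>s]) (use t1 \<open>te < t1\<close> \<gamma> \<sigma>s in auto)
    define \<eta> where "\<eta> = \<gamma> / (ts - te)"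
    have "0 < \<eta>" using \<gamma> te_ts(1) by (simp add: \<eta>_def)
    obtain C \<delta> where C: "0 < C" "0 < \<delta>" and separate:
      "\<And>e J u J0 u0 s t. 0 < e \<Longrightarrow> e \<le> \<delta> \<Longrightarrow>
        ode_solution (real_slice D e) (fast_field f e) J u \<Longrightarrow>
        ode_solution (real_slice D e) (fast_field f e) J0 u0 \<Longrightarrow>
        closed_segment s t \<subseteq> J \<inter> J0 \<inter> {c..d} \<Longrightarrow>
        (\<And>r. r \<in> closed_segment s t \<Longrightarrow> norm (u r - p r) \<le> \<delta> \<and> norm (u0 r - p r) \<le> \<delta>) \<Longrightarrow>
        norm (u t - u0 t) \<le> C * norm (u s - u0 s) * exp ((E t - E s + \<eta> * \<bar>t - s\<bar>) / e)"
      by (rule solutions_near_slow_curve_separate[OF f p pD eig(2)[unfolded A_def] E[unfolded A_def]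
            \<open>0 < \<eta>\<close>]) blast+
    \<comment> \<open>Two solutions within \<open>1 / 2\<close> of the slow curve differ by at most \<open>1\<close>.\<close>
    define \<delta>1 where "\<delta>1 = min \<delta> (1 / 2)"
    have "0 < \<delta>1" "\<delta>1 \<le> \<delta>" "\<delta>1 \<le> 1 / 2" using C(2) by (auto simp: \<delta>1_def)
    \<comment> \<open>For \<open>\<epsilon> < \<mu>\<close> the contribution \<open>\<epsilon> ln C\<close> is at most \<open>\<gamma>\<close>.\<close>
    define \<mu> where "\<mu> = min \<delta> (\<gamma> / (\<bar>ln C\<bar> + 1))"
    have "0 < \<mu>" using C(2) \<gamma> by (simp add: \<mu>_def)
    have lower: "- 3 * \<gamma> \<le> E t - E s" if st: "s = t0 \<and> t = t1 \<or> s = t1 \<and> t = t0" for s t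
    proof -
      have seg: "closed_segment s t = {t0..t1}"
        using st \<open>t0 < t1\<close> by (auto simp: closed_segment_eq_real_ivl)
      have far_t: "\<forall>\<^sub>F i in F. exp (- \<gamma> / \<epsilon> i) < norm (X i t - X0 i t)"
        using far_t0 far_t1 st by blast
      have "\<forall>\<^sub>F i in F. - 3 * \<gamma> \<le> E t - E s"
        using eps_small[OF \<open>0 < \<mu>\<close>] X_ode X0_ode X0_near[OF \<open>0 < \<delta>1\<close>]
          X_near[OF \<open>0 < \<delta>1\<close> t0(1) t1(1)] far_t
      proof eventually_elim
        case (elim i)
        have e: "0 < \<epsilon> i" "\<epsilon> i \<le> \<delta>" "\<epsilon> i * (\<bar>ln C\<bar> + 1) \<le> \<gamma>"
        proof -
          show "0 < \<epsilon> i" "\<epsilon> i \<le> \<delta>" using elim(1) by (auto simp: \<mu>_def)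
          have "\<epsilon> i \<le> \<gamma> / (\<bar>ln C\<bar> + 1)" using elim(1) by (auto simp: \<mu>_def)
          then show "\<epsilon> i * (\<bar>ln C\<bar> + 1) \<le> \<gamma>" by (simp add: pos_le_divide_eq)
        qed
        have sub: "{t0..t1} \<subseteq> {c..d}" using t0(1) t1(1) c(2) d(1) by auto
        have X0: "r \<in> J0 i" "norm (X0 i r - p r) < \<delta>1" if "r \<in> {t0..t1}" for r
          using elim(4) that sub by blast+
        have X: "r \<in> J i" "norm (X i r - p r) < \<delta>1" if "r \<in> {t0..t1}" for r
          using elim(5) that by blast+
        have "s \<in> {t0..t1}" using st \<open>t0 < t1\<close> by auto
        have "norm (X i s - X0 i s) \<le> norm (X i s - p s) + norm (X0 i s - p s)"
          using norm_triangle_ineq4[of "X i s - p s" "X0 i s - p s"] by simp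
        then have "norm (X i s - X0 i s) \<le> 1"
          using X(2)[OF \<open>s \<in> _\<close>] X0(2)[OF \<open>s \<in> _\<close>] \<open>\<delta>1 \<le> 1 / 2\<close> by linarith
        have "exp (- \<gamma> / \<epsilon> i) < norm (X i t - X0 i t)" by (rule elim(6))
        also have "\<dots> \<le> C * norm (X i s - X0 i s) * exp ((E t - E s + \<eta> * \<bar>t - s\<bar>) / \<epsilon> i)"
        proof (rule separate[OF e(1,2) _ elim(3)])
          show "ode_solution (real_slice D (\<epsilon> i)) (fast_field f (\<epsilon> i)) (J i) (X i)"
            using elim(2) by (simp add: maximal_ode_solution_def)
          show "closed_segment s t \<subseteq> J i \<inter> J0 i \<inter> {c..d}" using X(1) X0(1) sub seg by blast
          fix r assume "r \<in> closed_segment s t"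
          then show "norm (X i r - p r) \<le> \<delta> \<and> norm (X0 i r - p r) \<le> \<delta>"
            using X(2)[of r] X0(2)[of r] \<open>\<delta>1 \<le> \<delta>\<close> seg by auto
        qed
        also have "\<dots> \<le> C * 1 * exp ((E t - E s + \<gamma>) / \<epsilon> i)"
        proof (intro mult_mono)
          have "\<bar>t - s\<bar> \<le> ts - te" using st t0(1) t1(1) \<open>t0 < t1\<close> by auto
          then have "\<eta> * \<bar>t - s\<bar> \<le> \<eta> * (ts - te)" using \<open>0 < \<eta>\<close> by (intro mult_left_mono) auto
          then have "\<eta> * \<bar>t - s\<bar> \<le> \<gamma>" using te_ts(1) by (simp add: \<eta>_def)
          then show "exp ((E t - E s + \<eta> * \<bar>t - s\<bar>) / \<epsilon> i) \<le> exp ((E t - E s + \<gamma>) / \<epsilon> i)"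
            using e(1) by (simp add: divide_right_mono)
        qed (use C(1) \<open>norm (X i s - X0 i s) \<le> 1\<close> in auto)
        also have "\<dots> = exp (ln C + (E t - E s + \<gamma>) / \<epsilon> i)" using C(1) by (simp add: exp_add)
        finally have "- \<gamma> / \<epsilon> i < ln C + (E t - E s + \<gamma>) / \<epsilon> i" by simp
        then have "\<epsilon> i * (- \<gamma> / \<epsilon> i) < \<epsilon> i * (ln C + (E t - E s + \<gamma>) / \<epsilon> i)"
          using e(1) by (rule mult_strict_left_mono)
        then have "- \<gamma> < \<epsilon> i * ln C + (E t - E s + \<gamma>)"
          using e(1) by (simp add: distrib_left[of "\<epsilon> i" "ln C"])
        moreover have "\<epsilon> i * ln C \<le> \<epsilon> i * (\<bar>ln C\<bar> + 1)" using e(1) by (intro mult_left_mono) auto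
        ultimately show ?case using e(3) by linarith
      qed
      then show ?thesis by (rule ultrafilter_eventually_const[OF F])
    qed
    have "\<bar>E t1 - E t0\<bar> \<le> 3 * \<gamma>" using lower[of t0 t1] lower[of t1 t0] by linarith
    moreover have "\<bar>E ts - E t1\<bar> \<le> \<gamma> / 2"
      using \<sigma>s(2)[THEN bspec, of ts, THEN bspec, of t1] \<sigma>s(2)[THEN bspec, of t1, THEN bspec, of ts] \<sigma>s(1) t1
      by (intro abs_leI) auto
    moreover have "\<bar>E te - E t0\<bar> \<le> \<gamma> / 2"
      using \<sigma>e(2)[THEN bspec, of te, THEN bspec, of t0] \<sigma>e(2)[THEN bspec, of t0, THEN bspec, of te] \<sigma>e(1) t0
      by (intro abs_leI) auto
    ultimately show ?thesis by linarith
  qed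
  have "E ts = E te"
  proof (rule ccontr)
    assume "E ts \<noteq> E te"
    then show False using E_close[of "\<bar>E ts - E te\<bar> / 8"] by simp
  qed
  have int: "\<alpha> integrable_on {a..b}" if "{a..b} \<subseteq> {c..d}" for a b
    by (rule integrable_continuous_real[OF continuous_on_subset[OF \<alpha>_cont that]])
  have sub: "{te..ts} \<subseteq> {c..d}" "{c..ts} \<subseteq> {c..d}" using c d by auto
  have "E te + integral {te..ts} \<alpha> = E ts"
    unfolding E_def
    by (rule Henstock_Kurzweil_Integration.integral_combine) (use c(2) te_ts(1) int[OF sub(2)] in auto)
  with \<open>E ts = E te\<close> have "(\<alpha> has_integral 0) {te..ts}"
    using integrable_integral[OF int[OF sub(1)]] by simp
  then show ?thesis
    by (rule has_integral_eq[rotated]) (use eig(1) sub(1) in auto)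
qed

end
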